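(* Let $e(x)=\exp(2\pi i x)$ and for $n\in\mathbb{N}$ let $T_n(x)=\prod_{0\le r<n}(1-e(2^r x))$ for $x\in\mathbb{R}/\mathbb{Z}$. For integers $k\ge 1$ let $M_k(n)=\int_0^1|T_n(x)|^{2k}\,dx$, and let $\varrho_k>0$ be the constant such that $M_k(n)\sim C_k\varrho_k^n$ as $n\to\infty$ for some constant $C_k>0$. Let $$\delta_1=\prod_{n\ge1}\frac{2}{\sqrt3}\sin\Big(\frac{\pi}{3}\Big(1+\frac{(-1)^n}{2^n}\Big)\Big)=0.6027\ldots,\qquad \eta=0.506.$$ Then, as $k\to\infty$ (over integers $k\ge1$), $$\varrho_k=\tfrac12\,3^k\big(1+\delta_1^{2k}+O(\eta^{2k})\big),$$ i.e. there is an absolute constant $C$ with $\big|\varrho_k/(\tfrac12 3^k)-1-\delta_1^{2k}\big|\le C\eta^{2k}$ for all $k\ge1$.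
   Context: Note $T_n(x)=\sum_{0\le m<2^n}t(m)e(mx)$ where $t(m)\in\{\pm1\}$ is the Thue–Morse sequence ($t(m)=(-1)^{s_2(m)}$, $s_2$ the binary sum of digits). The existence, for each $k>0$, of constants $C_k,\varrho_k>0$ with $M_k(n)\sim C_k\varrho_k^n$ is known (Mauduit–Montgomery–Rivat); equivalently $\varrho_k=\lim_{n\to\infty}M_k(n)^{1/n}$. *)

theory Defs
  imports "HOL-Analysis.Analysis" "HOL-Library.Landau_Symbols"
begin

definition e :: "real \<Rightarrow> complex" where
  "e x = exp (2 * of_real pi * \<i> * of_real x)"

text \<open>Functions on \<open>\<real>/\<int>\<close> are rendered as 1-periodic functions on the reals.\<close>

definition T :: "nat \<Rightarrow> real \<Rightarrow> complex" where
  "T n x = (\<Prod>r<n. 1 - e (2 ^ r * x))"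

definition M :: "nat \<Rightarrow> nat \<Rightarrow> real" where
  "M k n = integral {0..1} (\<lambda>x. cmod (T n x) ^ (2 * k))"

text \<open>\<^const>\<open>prodinf\<close> starts at index 0, hence the shift \<open>n \<mapsto> Suc n\<close>.\<close>

definition \<delta>\<^sub>1 :: real where
  "\<delta>\<^sub>1 = prodinf (\<lambda>n. 2 / sqrt 3 * sin (pi / 3 * (1 + (- 1) ^ Suc n / 2 ^ Suc n)))"

definition \<eta> :: real where
  "\<eta> = 0.506"

end

theory Submission
  imports Defs "HOL-Real_Asymp.Real_Asymp"
begin

text \<open>
  Put \<open>w(x) = 4/3 sin\<^sup>2(\<pi>x)\<close>. Up to the factor \<open>(3\<^sup>k/2)\<^sup>n\<close>, the moment \<open>M\<^sub>k(n)\<close> is the integral of the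
  \<open>n\<close>-th iterate at \<open>1\<close> of the transfer operator of the doubling map with weight \<open>w\<^sup>k\<close>. This
  operator preserves the cosine polynomials of degree at most \<open>k\<close>, so compactness yields an eigenfunction
  \<open>f \<ge> 0\<close> with eigenvalue \<open>\<mu> = \<rho>\<^sub>k / (3\<^sup>k/2)\<close>. Modulo \<open>x \<mapsto> -x\<close> the point \<open>1/3\<close> is fixed by doubling and has weight
  1, its other preimage being \<open>1/6\<close>; hence \<open>(\<mu> - 1) f(1/3) = 3\<^sup>-\<^sup>k f(1/6)\<close>. Following the backward orbit of
  \<open>1/6\<close> that converges to \<open>1/3\<close> (a homoclinic orbit) produces the main term \<open>\<delta>\<^sub>1\<^sup>2\<^sup>k\<close>. The other
  branches are controlled by \<open>f \<le> 4 f(1/3) w\<^sup>-\<^sup>k\<^sup>/\<^sup>3\<close>, which comes from \<open>w(y)\<^sup>2 w(2y) \<le> 1\<close> and holds for large \<open>k\<close>.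
\<close>

section \<open>The homoclinic orbit and \<open>\<delta>\<^sub>1\<close>\<close>

text \<open>This is |1 - e(x)|^2 / 3; the divisor 3 gives the point 1/3 weight 1. In cosine form,
  multiplication by it raises the degree of a cosine polynomial by one.\<close>

definition wt :: "real \<Rightarrow> real" where
  "wt x = 2 / 3 * (1 - cos (2 * pi * x))"

lemma wt_nonneg [simp]: "0 \<le> wt x"
  by (simp add: wt_def)

lemma wt_le: "wt x \<le> 4 / 3"
  using cos_ge_minus_one[of "2 * pi * x"] by (simp add: wt_def del: cos_ge_minus_one)

lemma wt_minus [simp]: "wt (- x) = wt x"
  by (simp add: wt_def)

lemma wt_add_1 [simp]: "wt (x + 1) = wt x"
  by (simp add: wt_def distrib_left cos_periodic[of "2 * pi * x", simplified])

lemma wt_one_minus [simp]: "wt (1 - x) = wt x"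
  using wt_add_1[of "- x"] by (simp add: algebra_simps)

lemma wt_eq_sin: "wt x = 4 / 3 * (sin (pi * x))\<^sup>2"
  using cos_double_sin[of "pi * x"] by (simp add: wt_def algebra_simps)

lemma wt_one_third [simp]: "wt (1 / 3) = 1"
  by (simp add: wt_def cos_120)

lemma wt_half_eq: "wt (x / 2) = 2 / 3 * (1 - cos (pi * x))"
  by (simp add: wt_def)

lemma wt_half_reflect_eq: "wt ((1 - x) / 2) = 2 / 3 * (1 + cos (pi * x))"
proof -
  have "cos (2 * pi * ((1 - x) / 2)) = cos (pi - pi * x)"
    by (rule arg_cong[of _ _ cos]) (simp add: field_simps)
  then show ?thesis by (simp add: wt_def cos_diff)
qed

lemma cos_lipschitz: "\<bar>cos x - cos y\<bar> \<le> \<bar>x - y\<bar>" for x y :: real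
proof -
  have "norm (cos x - cos y) \<le> 1 * norm (x - y)"
    by (rule field_differentiable_bound[where S = UNIV and f' = "\<lambda>x. - sin x"])
       (auto intro!: derivative_eq_intros)
  then show ?thesis by simp
qed

lemma wt_lipschitz: "\<bar>wt x - wt y\<bar> \<le> 5 * \<bar>x - y\<bar>"
proof -
  have "\<bar>wt x - wt y\<bar> = 2 / 3 * \<bar>cos (2 * pi * y) - cos (2 * pi * x)\<bar>"
    by (simp add: wt_def abs_if field_simps)
  also have "\<dots> \<le> 2 / 3 * \<bar>2 * pi * y - 2 * pi * x\<bar>"
    using cos_lipschitz by (intro mult_left_mono) auto
  also have "\<bar>2 * pi * y - 2 * pi * x\<bar> = 2 * pi * \<bar>x - y\<bar>"
    by (simp add: right_diff_distrib[symmetric] abs_mult abs_minus_commute)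
  also have "2 / 3 * (2 * pi * \<bar>x - y\<bar>) = (4 / 3 * pi) * \<bar>x - y\<bar>" by simp
  also have "\<dots> \<le> 5 * \<bar>x - y\<bar>"
    using pi_approx by (intro mult_right_mono) auto
  finally show ?thesis .
qed

text \<open>\<open>2 hom (n + 1) = 1 - hom n\<close>, so modulo sign and integers doubling maps \<open>hom (n + 1)\<close> to \<open>hom n\<close>; the
  orbit ends in \<open>hom 1 = 1/6\<close>, which is mapped to \<open>1/3\<close>. In terms of \<open>hcos\<close> this is an algebraic
  recursion, which allows rational enclosures without approximating \<open>\<pi>\<close>.\<close>

definition hom :: "nat \<Rightarrow> real" where
  "hom n = (1 + (- 1 / 2) ^ n) / 3"

definition hcos :: "nat \<Rightarrow> real" where
  "hcos n = cos (pi * hom n)"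

text \<open>These are the squared partial products of \<open>\<delta>\<^sub>1\<close>: the weight of
  an orbit point is the square of the corresponding factor.\<close>

definition Q :: "nat \<Rightarrow> real" where
  "Q n = (\<Prod>i<n. wt (hom (Suc i)))"

lemma hom_0: "hom 0 = 2 / 3"
  by (simp add: hom_def)

lemma hom_1: "hom (Suc 0) = 1 / 6"
  by (simp add: hom_def)

lemma hom_Suc: "hom (Suc n) = (1 - hom n) / 2"
  by (simp add: hom_def field_simps)

lemma hom_dist: "\<bar>hom n - 1 / 3\<bar> = (1 / 2) ^ n / 3"
proof -
  have "hom n - 1 / 3 = (- 1 / 2) ^ n / 3" by (simp add: hom_def field_simps)
  then show ?thesis by (simp only: abs_divide power_abs) simp
qed

lemma wt_hom_Suc: "wt (hom (Suc n)) = 2 / 3 * (1 + hcos n)"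
  by (simp add: hom_Suc hcos_def wt_half_reflect_eq)

lemma wt_hom_half: "wt (hom n / 2) = 2 / 3 * (1 - hcos n)"
  by (simp add: hcos_def wt_half_eq)

lemma hom_range: "n \<ge> 1 \<Longrightarrow> hom n \<in> {0..1/2}"
proof -
  assume "n \<ge> 1"
  then obtain m where n: "n = Suc m" by (cases n) auto
  have "\<bar>hom m - 1 / 3\<bar> \<le> 1 / 3"
    unfolding hom_dist by (simp add: power_le_one)
  then have "0 \<le> hom m" "hom m \<le> 1" by linarith+
  then show ?thesis unfolding n hom_Suc by auto
qed

lemma hcos_nonneg: "n \<ge> 1 \<Longrightarrow> 0 \<le> hcos n"
  unfolding hcos_def using hom_range[of n] pi_gt_zero
  by (intro cos_ge_zero) (auto simp: field_simps intro: order.trans[of _ 0])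

text \<open>Double-angle formula at \<open>hom (Suc n)\<close>. Together with
  \<open>hcos 0 = -1/2\<close> and nonnegativity at positive indices it determines the whole
  sequence.\<close>

lemma hcos_Suc: "2 * (hcos (Suc n))\<^sup>2 = 1 - hcos n"
proof -
  have "cos (2 * (pi * hom (Suc n))) = cos (pi - pi * hom n)"
    by (rule arg_cong[of _ _ cos]) (simp add: hom_Suc field_simps)
  then have "cos (2 * (pi * hom (Suc n))) = - hcos n" by (simp add: hcos_def)
  then show ?thesis unfolding cos_double_cos hcos_def by simp
qed

lemma hcos_0: "hcos 0 = - 1 / 2"
  using cos_120 by (simp add: hcos_def hom_0 mult.commute)

lemma Q_0 [simp]: "Q 0 = 1"
  by (simp add: Q_def)

lemma Q_Suc: "Q (Suc n) = Q n * wt (hom (Suc n))"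
  by (simp add: Q_def)

lemma Q_nonneg [simp]: "0 \<le> Q n"
  by (simp add: Q_def prod_nonneg)

text \<open>The interval is invariant under the recursion: (1 - 7/8)/2 is exactly (1/4)^2, and (1 -
  1/4)/2 = 3/8 lies below (7/8)^2.\<close>

lemma hcos_bounds: "1 / 4 \<le> hcos (Suc n) \<and> hcos (Suc n) \<le> 7 / 8"
proof (induction n)
  case 0
  have h: "0 \<le> hcos (Suc 0)" by (rule hcos_nonneg) simp
  have "(hcos (Suc 0))\<^sup>2 = 3 / 4" using hcos_Suc[of 0] by (simp add: hcos_0)
  then have "(1 / 4)\<^sup>2 \<le> (hcos (Suc 0))\<^sup>2" "(hcos (Suc 0))\<^sup>2 \<le> (7 / 8)\<^sup>2"
    by (auto simp: power2_eq_square)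
  then show ?case using h by (auto intro: power2_le_imp_le)
next
  case (Suc n)
  have h: "0 \<le> hcos (Suc (Suc n))" by (rule hcos_nonneg) simp
  have "(1 / 4)\<^sup>2 \<le> (hcos (Suc (Suc n)))\<^sup>2" "(hcos (Suc (Suc n)))\<^sup>2 \<le> (7 / 8)\<^sup>2"
    using Suc hcos_Suc[of "Suc n"] by (auto simp: power2_eq_square)
  then show ?case using h by (auto intro: power2_le_imp_le)
qed

text \<open>The recursion is a decreasing map with fixed point 1/2, so consecutive values lie on
  opposite sides of 1/2.\<close>

lemma hcos_parity: "1 / 2 \<le> hcos (Suc (2 * n)) \<and> hcos (Suc (Suc (2 * n))) \<le> 1 / 2"
proof -
  have *: "hcos m \<le> 1 / 2 \<Longrightarrow> 1 / 2 \<le> hcos (Suc m)" for m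
  proof -
    assume "hcos m \<le> 1 / 2"
    then have "(1 / 2)\<^sup>2 \<le> (hcos (Suc m))\<^sup>2" using hcos_Suc[of m] by (simp add: power2_eq_square)
    then show ?thesis using hcos_nonneg[of "Suc m"] by (auto intro: power2_le_imp_le)
  qed
  have **: "1 / 2 \<le> hcos m \<Longrightarrow> hcos (Suc m) \<le> 1 / 2" for m
  proof -
    assume "1 / 2 \<le> hcos m"
    then have "(hcos (Suc m))\<^sup>2 \<le> (1 / 2)\<^sup>2" using hcos_Suc[of m] by (simp add: power2_eq_square)
    then show ?thesis by (rule power2_le_imp_le) simp
  qed
  show ?thesis
  proof (induction n)
    case 0
    show ?case using *[of 0] **[of "Suc 0"] by (simp add: hcos_0)
  next
    case (Suc n)
    then show ?case using *[of "Suc (Suc (2 * n))"] **[of "Suc (Suc (Suc (2 * n)))"] by simp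
  qed
qed

text \<open>The correction factor is at least 1 iff \<open>hcos (n + 1) \<le> 1/2\<close>, which alternates with \<open>n\<close>: the odd
  partial products increase to \<open>\<delta>\<^sub>1\<^sup>2\<close> and the even ones decrease to it.\<close>

lemma Q_Suc_Suc:
  "Q (Suc (Suc n)) = Q n * (1 + (1 - 2 * hcos (Suc n)) * (4 * (hcos (Suc n))\<^sup>2 + 6 * hcos (Suc n) - 1) / 9)"
proof -
  have y: "hcos n = 1 - 2 * (hcos (Suc n))\<^sup>2" using hcos_Suc[of n] by simp
  have "Q (Suc (Suc n)) = Q n * ((2 / 3 * (1 + hcos n)) * (2 / 3 * (1 + hcos (Suc n))))"
    by (simp add: Q_Suc wt_hom_Suc)
  also have "(2 / 3 * (1 + hcos n)) * (2 / 3 * (1 + hcos (Suc n)))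
    = 1 + (1 - 2 * hcos (Suc n)) * (4 * (hcos (Suc n))\<^sup>2 + 6 * hcos (Suc n) - 1) / 9"
    unfolding y by (simp add: field_simps power2_eq_square)
  finally show ?thesis .
qed

lemma Q_odd_mono: "Q (2 * n + 1) \<le> Q (2 * (n + m) + 1)"
proof (induction m)
  case (Suc m)
  define z where "z = hcos (Suc (2 * (n + m) + 1))"
  have z: "z \<le> 1 / 2" "1 / 4 \<le> z"
    using hcos_parity[of "n + m"] hcos_bounds[of "2 * (n + m) + 1"] by (auto simp: z_def)
  have "0 \<le> (1 - 2 * z) * (4 * z\<^sup>2 + 6 * z - 1)"
    using z zero_le_power2[of z] by (intro mult_nonneg_nonneg) linarith+
  then have "Q (2 * (n + m) + 1) * 1 \<le> Q (Suc (Suc (2 * (n + m) + 1)))"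
    unfolding Q_Suc_Suc z_def[symmetric] by (intro mult_left_mono) auto
  then show ?case using Suc by simp
qed simp

lemma Q_even_antimono: "Q (2 * (n + m)) \<le> Q (2 * n)"
proof (induction m)
  case (Suc m)
  define z where "z = hcos (Suc (2 * (n + m)))"
  have z: "1 / 2 \<le> z"
    using hcos_parity[of "n + m"] by (auto simp: z_def)
  have "0 \<le> (2 * z - 1) * (4 * z\<^sup>2 + 6 * z - 1)"
    using z zero_le_power2[of z] by (intro mult_nonneg_nonneg) linarith+
  then have "(1 - 2 * z) * (4 * z\<^sup>2 + 6 * z - 1) \<le> 0"
    by (simp add: algebra_simps)
  then have "Q (Suc (Suc (2 * (n + m)))) \<le> Q (2 * (n + m)) * 1"
    unfolding Q_Suc_Suc z_def[symmetric] by (intro mult_left_mono) auto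
  then show ?case using Suc by simp
qed simp

lemma Q_odd_le_even: "Q (Suc (2 * n)) \<le> Q (2 * (n + 1))"
proof -
  have "1 \<le> wt (hom (Suc (Suc (2 * n))))"
    using hcos_parity[of n] by (simp add: wt_hom_Suc)
  then have "Q (Suc (2 * n)) * 1 \<le> Q (Suc (2 * n)) * wt (hom (Suc (Suc (2 * n))))"
    by (intro mult_left_mono) auto
  then show ?thesis by (simp add: Q_Suc)
qed

text \<open>Even products decrease and each odd one lies below its even successor, so
  \<open>m = 2 * n - 1\<close> is still covered.\<close>

lemma Q_le_Q_even:
  assumes "2 * n \<le> Suc m"
  shows "Q m \<le> Q (2 * n)"
proof (cases "even m")
  case True
  then obtain i where i: "m = 2 * i" by (auto elim: evenE)
  then have "n \<le> i" using assms by linarith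
  then show ?thesis using Q_even_antimono[of n "i - n"] by (simp add: i)
next
  case False
  then obtain i where i: "m = Suc (2 * i)" by (auto elim: oddE)
  then have "n \<le> i + 1" using assms by linarith
  then show ?thesis using Q_odd_le_even[of i] Q_even_antimono[of n "i + 1 - n"] by (simp add: i)
qed

lemma Q_le_1: "Q n \<le> 1"
  using Q_le_Q_even[of 0 n] by simp

section \<open>Rational enclosures along the orbit and the value of
  \<open>\<delta>\<^sub>1\<close>\<close>

definition hom_bounds :: "nat \<Rightarrow> real \<Rightarrow> real \<Rightarrow> real \<Rightarrow> real \<Rightarrow> bool" where
  "hom_bounds n l h q p \<longleftrightarrow> l \<le> hcos n \<and> hcos n \<le> h \<and> q \<le> Q n \<and> Q n \<le> p"

text \<open>One step of interval arithmetic. Comparing squares instead of taking roots leaves only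
  rational side conditions, which evaluate numerically.\<close>

lemma hom_bounds_Suc:
  assumes "hom_bounds n l h q p" "m = Suc n" "-1 \<le> l" "0 \<le> q" "0 \<le> l'" "0 \<le> h'"
    "2 * (l' * l') \<le> 1 - h" "1 - l \<le> 2 * (h' * h')" "q' \<le> q * (2 / 3 * (1 + l))" "p * (2 / 3 * (1 + h)) \<le> p'"
  shows "hom_bounds m l' h' q' p'"
proof -
  have b: "l \<le> hcos n" "hcos n \<le> h" "q \<le> Q n" "Q n \<le> p"
    using assms(1) by (auto simp: hom_bounds_def)
  have "l'\<^sup>2 \<le> (hcos m)\<^sup>2" "(hcos m)\<^sup>2 \<le> h'\<^sup>2"
    using hcos_Suc[of n] assms b by (auto simp: power2_eq_square)
  then have y: "l' \<le> hcos m" "hcos m \<le> h'"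
    using hcos_nonneg[of m] assms by (auto intro: power2_le_imp_le)
  have "q * (2 / 3 * (1 + l)) \<le> Q n * (2 / 3 * (1 + hcos n))"
    using b assms by (intro mult_mono) auto
  moreover have "Q n * (2 / 3 * (1 + hcos n)) \<le> p * (2 / 3 * (1 + h))"
    using b assms order.trans[OF Q_nonneg b(4)] by (intro mult_mono) auto
  ultimately show ?thesis
    using y assms by (simp add: hom_bounds_def Q_Suc wt_hom_Suc)
qed

lemma hom_bounds0: "hom_bounds 0 (-0.5) (-0.5) 1 1"
  by (simp add: hom_bounds_def hcos_0)

text \<open>As \<open>\<delta>\<^sub>1 = 0.60270033\<dots>\<close> is so close to \<open>0.6027\<close>, the lower bound only follows at \<open>n = 19\<close> or later.\<close>

lemma hom_bounds1: "hom_bounds 1 0.8660254037 0.8660254038 0.3333333333 0.3333333334"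
  by (rule hom_bounds_Suc[OF hom_bounds0]) simp_all
lemma hom_bounds2: "hom_bounds 2 0.2588190450 0.2588190452 0.4146723118 0.4146723121"
  by (rule hom_bounds_Suc[OF hom_bounds1]) simp_all
lemma hom_bounds3: "hom_bounds 3 0.6087614289 0.6087614291 0.3479982690 0.3479982694"
  by (rule hom_bounds_Suc[OF hom_bounds2]) simp_all
lemma hom_bounds4: "hom_bounds 4 0.4422886901 0.4422886903 0.3732307949 0.3732307955"
  by (rule hom_bounds_Suc[OF hom_bounds3]) simp_all
lemma hom_bounds5: "hom_bounds 5 0.5280678506 0.5280678508 0.3588710361 0.3588710369"
  by (rule hom_bounds_Suc[OF hom_bounds4]) simp_all
lemma hom_bounds6: "hom_bounds 6 0.4857633936 0.4857633938 0.3655861951 0.3655861961"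
  by (rule hom_bounds_Suc[OF hom_bounds5]) simp_all
lemma hom_bounds7: "hom_bounds 7 0.5070683416 0.5070683418 0.3621163905 0.3621163917"
  by (rule hom_bounds_Suc[OF hom_bounds6]) simp_all
lemma hom_bounds8: "hom_bounds 8 0.4964532496 0.4964532498 0.3638227653 0.3638227667"
  by (rule hom_bounds_Suc[OF hom_bounds7]) simp_all
lemma hom_bounds9: "hom_bounds 9 0.5017702413 0.5017702415 0.3629625062 0.3629625078"
  by (rule hom_bounds_Suc[OF hom_bounds8]) simp_all
lemma hom_bounds10: "hom_bounds 10 0.4991140944 0.4991140946 0.3633908603 0.3633908620"
  by (rule hom_bounds_Suc[OF hom_bounds9]) simp_all
lemma hom_bounds11: "hom_bounds 11 0.5004427566 0.5004427568 0.3631762403 0.3631762421"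
  by (rule hom_bounds_Suc[OF hom_bounds10]) simp_all
lemma hom_bounds12: "hom_bounds 12 0.4997785725 0.4997785727 0.3632834394 0.3632834413"
  by (rule hom_bounds_Suc[OF hom_bounds11]) simp_all
lemma hom_bounds13: "hom_bounds 13 0.5001107013 0.5001107015 0.3632298121 0.3632298141"
  by (rule hom_bounds_Suc[OF hom_bounds12]) simp_all
lemma hom_bounds14: "hom_bounds 14 0.4999446461 0.4999446463 0.3632566187 0.3632566209"
  by (rule hom_bounds_Suc[OF hom_bounds13]) simp_all
lemma hom_bounds15: "hom_bounds 15 0.5000276760 0.5000276762 0.3632432135 0.3632432159"
  by (rule hom_bounds_Suc[OF hom_bounds14]) simp_all
lemma hom_bounds16: "hom_bounds 16 0.4999861617 0.4999861619 0.3632499155 0.3632499181"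
  by (rule hom_bounds_Suc[OF hom_bounds15]) simp_all
lemma hom_bounds17: "hom_bounds 17 0.5000069190 0.5000069192 0.3632465643 0.3632465670"
  by (rule hom_bounds_Suc[OF hom_bounds16]) simp_all
lemma hom_bounds18: "hom_bounds 18 0.4999965403 0.4999965405 0.3632482398 0.3632482426"
  by (rule hom_bounds_Suc[OF hom_bounds17]) simp_all
lemma hom_bounds19: "hom_bounds 19 0.5000017297 0.5000017299 0.3632474019 0.3632474049"
  by (rule hom_bounds_Suc[OF hom_bounds18]) simp_all
lemma hom_bounds20: "hom_bounds 20 0.4999991350 0.4999991352 0.3632478207 0.3632478239"
  by (rule hom_bounds_Suc[OF hom_bounds19]) simp_all
lemma hom_bounds21: "hom_bounds 21 0.5000004323 0.5000004325 0.3632476112 0.3632476145"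
  by (rule hom_bounds_Suc[OF hom_bounds20]) simp_all

lemma Q_step: "\<bar>Q (Suc n) - Q n\<bar> \<le> (1 / 2) ^ n"
proof -
  have "\<bar>wt (hom (Suc n)) - wt (1 / 3)\<bar> \<le> 5 * ((1 / 2) ^ Suc n / 3)"
    using wt_lipschitz[of "hom (Suc n)" "1 / 3"] unfolding hom_dist .
  also have "\<dots> \<le> (1 / 2) ^ n" by simp
  finally have *: "\<bar>wt (hom (Suc n)) - 1\<bar> \<le> (1 / 2) ^ n" by simp
  have "\<bar>Q (Suc n) - Q n\<bar> = Q n * \<bar>wt (hom (Suc n)) - 1\<bar>"
  proof -
    have "Q (Suc n) - Q n = Q n * (wt (hom (Suc n)) - 1)" by (simp add: Q_Suc algebra_simps)
    then show ?thesis by (simp add: abs_mult)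
  qed
  also have "\<dots> \<le> 1 * (1 / 2) ^ n"
    using * Q_le_1[of n] by (intro mult_mono) auto
  finally show ?thesis by simp
qed

text \<open>The factors of \<open>\<delta>\<^sub>1\<close> are the nonnegative square roots of the
  weights along the orbit. They approach 1 geometrically, so the product converges
  absolutely.\<close>

lemma Q_tendsto: "Q \<longlonglongrightarrow> \<delta>\<^sub>1\<^sup>2" and delta_nonneg: "0 \<le> \<delta>\<^sub>1"
proof -
  define u where "u = (\<lambda>n. 2 / sqrt 3 * sin (pi / 3 * (1 + (- 1) ^ Suc n / 2 ^ Suc n)))"
  have u_eq: "u n = 2 / sqrt 3 * sin (pi * hom (Suc n))" for n
    unfolding u_def hom_def power_divide by simp
  have u_nonneg: "0 \<le> u n" for n
    unfolding u_eq using hom_range[of "Suc n"] pi_gt_zero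
    by (intro mult_nonneg_nonneg sin_ge_zero) (auto simp: field_simps)
  have u_sq: "(u n)\<^sup>2 = wt (hom (Suc n))" for n
    unfolding u_eq wt_eq_sin by (simp add: power_mult_distrib power_divide)
  have u_near: "\<bar>u n - 1\<bar> \<le> (1 / 2) ^ n" for n
  proof -
    \<comment> \<open>Since \<open>u n + 1\<close> is at least 1, the distance of the square from 1
      dominates that of \<open>u n\<close>.\<close>
    have "\<bar>u n - 1\<bar> * 1 \<le> \<bar>u n - 1\<bar> * \<bar>u n + 1\<bar>"
      using u_nonneg[of n] by (intro mult_left_mono) auto
    also have "\<dots> = \<bar>wt (hom (Suc n)) - wt (1 / 3)\<bar>"
      by (simp add: abs_mult[symmetric] algebra_simps power2_eq_square flip: u_sq)
    also have "\<dots> \<le> 5 * ((1 / 2) ^ Suc n / 3)"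
      using wt_lipschitz[of "hom (Suc n)" "1 / 3"] unfolding hom_dist .
    also have "\<dots> \<le> (1 / 2) ^ n" by simp
    finally show ?thesis by simp
  qed
  have "summable (\<lambda>n. norm (u n - 1))"
    by (rule summable_comparison_test'[where g = "\<lambda>n. (1 / 2) ^ n" and N = 0])
       (use u_near in \<open>auto simp: summable_geometric\<close>)
  then have "convergent_prod u"
    by (intro abs_convergent_prod_imp_convergent_prod summable_imp_abs_convergent_prod)
  then have "(\<lambda>n. \<Prod>i\<le>n. u i) \<longlonglongrightarrow> prodinf u"
    by (rule convergent_prod_LIMSEQ)
  moreover have "prodinf u = \<delta>\<^sub>1"
    unfolding \<delta>\<^sub>1_def u_def ..
  ultimately have lim: "(\<lambda>n. \<Prod>i\<le>n. u i) \<longlonglongrightarrow> \<delta>\<^sub>1" by simp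
  have "(\<Prod>i\<le>n. u i)\<^sup>2 = Q (Suc n)" for n
    unfolding Q_def lessThan_Suc_atMost by (simp add: prod_power_distrib u_sq)
  with tendsto_power[OF lim, of 2] have "(\<lambda>n. Q (Suc n)) \<longlonglongrightarrow> \<delta>\<^sub>1\<^sup>2" by simp
  then show "Q \<longlonglongrightarrow> \<delta>\<^sub>1\<^sup>2" by (simp add: filterlim_sequentially_Suc)
  show "0 \<le> \<delta>\<^sub>1"
    by (rule tendsto_lowerbound[OF lim]) (auto intro!: always_eventually prod_nonneg u_nonneg)
qed

text \<open>Odd products bound the limit from below and even ones from above; 12 is the first even
  index whose product lies below 0.6028^2.\<close>

lemma delta_bounds: "0.6027 \<le> \<delta>\<^sub>1" "\<delta>\<^sub>1 < 0.6028"
proof -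
  have "Q 21 \<le> Q n" if "odd n" "n \<ge> 21" for n
  proof -
    from that obtain i where i: "n = 2 * i + 1" by (auto elim: oddE)
    then show ?thesis using that Q_odd_mono[of 10 "i - 10"] by simp
  qed
  then have "Q 21 \<le> Q (2 * n + 21)" for n by simp
  moreover have "(\<lambda>n. Q (2 * n + 21)) \<longlonglongrightarrow> \<delta>\<^sub>1\<^sup>2"
    by (rule filterlim_compose[OF Q_tendsto]) (rule filterlim_at_top_mono[OF filterlim_ident], auto)
  ultimately have "Q 21 \<le> \<delta>\<^sub>1\<^sup>2"
    by (intro tendsto_lowerbound[of _ _ sequentially]) auto
  then have "0.6027\<^sup>2 \<le> \<delta>\<^sub>1\<^sup>2"
    using hom_bounds21 by (simp add: hom_bounds_def power2_eq_square)
  then show "0.6027 \<le> \<delta>\<^sub>1"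
    using delta_nonneg by (rule power2_le_imp_le)
  have "Q n \<le> Q 12" if "n \<ge> 12" for n
    using Q_le_Q_even[of 6 n] that by simp
  then have "\<delta>\<^sub>1\<^sup>2 \<le> Q 12"
    by (intro tendsto_upperbound[OF Q_tendsto]) (auto simp: eventually_sequentially)
  then have "\<delta>\<^sub>1\<^sup>2 < 0.6028\<^sup>2"
    using hom_bounds12 by (simp add: hom_bounds_def power2_eq_square)
  then show "\<delta>\<^sub>1 < 0.6028"
    by (rule power2_less_imp_less) simp
qed

lemma Q_dist: "\<bar>Q n - \<delta>\<^sub>1\<^sup>2\<bar> \<le> 2 * (1 / 2) ^ n"
proof -
  \<comment> \<open>Subtracting the remaining geometric tail makes the induction on \<open>m\<close>
    close.\<close>
  have "\<bar>Q n - Q (n + m)\<bar> \<le> 2 * (1 / 2) ^ n - 2 * (1 / 2) ^ (n + m)" for m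
  proof (induction m)
    case (Suc m)
    then show ?case using Q_step[of "n + m"] by simp
  qed simp
  then have *: "\<bar>Q n - Q (n + m)\<bar> \<le> 2 * (1 / 2) ^ n" for m
    by (rule order.trans) simp
  have "(\<lambda>m. \<bar>Q n - Q (n + m)\<bar>) \<longlonglongrightarrow> \<bar>Q n - \<delta>\<^sub>1\<^sup>2\<bar>"
    using LIMSEQ_ignore_initial_segment[OF Q_tendsto, of n]
    by (intro tendsto_intros) (simp add: add.commute)
  then show ?thesis
    by (rule tendsto_upperbound) (use * in auto)
qed

lemma Q_2_le: "Q 2 \<le> 0.415" and Q_le: "3 \<le> n \<Longrightarrow> Q n \<le> 0.3735"
  using hom_bounds2 hom_bounds4 Q_le_Q_even[of 2 n] by (auto simp: hom_bounds_def)

text \<open>\<open>hom n / 2\<close> is the preimage of \<open>hom n\<close> off the orbit. From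
  index 3 on, \<open>hcos\<close> stays in [0.441, 0.61], which is invariant because (1 - 0.61)/2 =
  0.195 exceeds 0.441^2.\<close>

lemma wt_hom_half_le:
  assumes "3 \<le> n"
  shows "wt (hom n / 2) \<le> 0.373"
proof -
  have "0.441 \<le> hcos n \<and> hcos n \<le> 0.61"
    using assms
  proof (induction n rule: dec_induct)
    case base
    show ?case using hom_bounds3 by (simp add: hom_bounds_def)
  next
    case (step n)
    have "0.441\<^sup>2 \<le> (hcos (Suc n))\<^sup>2" "(hcos (Suc n))\<^sup>2 \<le> 0.61\<^sup>2"
      using step.IH hcos_Suc[of n] by (auto simp: power2_eq_square)
    then show ?case using hcos_nonneg[of "Suc n"] by (auto intro: power2_le_imp_le)
  qed
  then show ?thesis by (simp add: wt_hom_half)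
qed

section \<open>Cosine polynomials and the transfer operator\<close>

lemma cos_2pi_of_int_integral:
  assumes "m \<in> \<int>"
  shows "((\<lambda>x. cos (2 * pi * m * x)) has_integral (if m = 0 then 1 else 0)) {0..1}"
proof (cases "m = 0")
  case True
  then show ?thesis using has_integral_const_real[of "1::real" 0 1] by simp
next
  case False
  have "((\<lambda>x. cos (2 * pi * m * x)) has_integral
      (sin (2 * pi * m * 1) / (2 * pi * m) - sin (2 * pi * m * 0) / (2 * pi * m))) {0..1}"
    using False
    by (intro fundamental_theorem_of_calculus)
       (auto intro!: derivative_eq_intros simp flip: has_real_derivative_iff_has_vector_derivative)
  then show ?thesis using False sin_integer_2pi[OF assms] by simp
qed

text \<open>Even 1-periodic trigonometric polynomials. Fixing the degree gives a finite-dimensional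
  space, where bounded coefficients yield compactness.\<close>

definition cospoly :: "nat \<Rightarrow> (real \<Rightarrow> real) \<Rightarrow> bool" where
  "cospoly d f \<longleftrightarrow> (\<exists>c. \<forall>x. f x = (\<Sum>j\<le>d. c j * cos (2 * pi * real j * x)))"

lemma cospoly_cos: "j \<le> d \<Longrightarrow> cospoly d (\<lambda>x. cos (2 * pi * real j * x))"
  unfolding cospoly_def
  by (rule exI[of _ "\<lambda>i. if i = j then 1 else 0"]) (simp add: mult_delta_left)

lemma cospoly_const: "cospoly d (\<lambda>_. a)"
  unfolding cospoly_def
  by (rule exI[of _ "\<lambda>i. if i = 0 then a else 0"]) (simp add: mult_delta_left)

lemma cospoly_add: "cospoly d f \<Longrightarrow> cospoly d g \<Longrightarrow> cospoly d (\<lambda>x. f x + g x)"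
proof -
  assume "cospoly d f" "cospoly d g"
  then obtain b c where "\<And>x. f x = (\<Sum>j\<le>d. b j * cos (2 * pi * real j * x))"
    "\<And>x. g x = (\<Sum>j\<le>d. c j * cos (2 * pi * real j * x))"
    by (auto simp: cospoly_def)
  then show ?thesis
    unfolding cospoly_def by (intro exI[of _ "\<lambda>j. b j + c j"]) (simp add: distrib_right sum.distrib)
qed

lemma cospoly_cmult: "cospoly d f \<Longrightarrow> cospoly d (\<lambda>x. a * f x)"
proof -
  assume "cospoly d f"
  then obtain c where "\<And>x. f x = (\<Sum>j\<le>d. c j * cos (2 * pi * real j * x))"
    by (auto simp: cospoly_def)
  then show ?thesis
    unfolding cospoly_def by (intro exI[of _ "\<lambda>j. a * c j"]) (simp add: sum_distrib_left mult.assoc)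
qed

lemma cospoly_sum: "(\<And>i. i \<in> A \<Longrightarrow> cospoly d (f i)) \<Longrightarrow> cospoly d (\<lambda>x. \<Sum>i\<in>A. f i x)"
  by (induction A rule: infinite_finite_induct) (auto intro: cospoly_add cospoly_const)

lemma cospoly_mult_cos: "cospoly d f \<Longrightarrow> cospoly (Suc d) (\<lambda>x. cos (2 * pi * x) * f x)"
proof -
  assume "cospoly d f"
  then obtain c where c: "\<And>x. f x = (\<Sum>j\<le>d. c j * cos (2 * pi * real j * x))"
    by (auto simp: cospoly_def)
  have "cospoly (Suc d) (\<lambda>x. cos (2 * pi * x) * cos (2 * pi * real j * x))" if "j \<le> d" for j
  proof (cases j)
    case 0
    then show ?thesis using cospoly_cos[of 1 "Suc d"] by simp
  next
    case (Suc i)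
    have "(\<lambda>x. cos (2 * pi * x) * cos (2 * pi * real j * x))
      = (\<lambda>x. 1 / 2 * (cos (2 * pi * real (Suc j) * x) + cos (2 * pi * real i * x)))"
    proof
      fix x
      show "cos (2 * pi * x) * cos (2 * pi * real j * x)
        = 1 / 2 * (cos (2 * pi * real (Suc j) * x) + cos (2 * pi * real i * x))"
        using cos_times_cos[of "2 * pi * real j * x" "2 * pi * x"]
        by (simp add: Suc algebra_simps)
    qed
    moreover have "cospoly (Suc d) (\<lambda>x. 1 / 2 * (cos (2 * pi * real (Suc j) * x) + cos (2 * pi * real i * x)))"
      using that Suc by (intro cospoly_cmult cospoly_add cospoly_cos) auto
    ultimately show ?thesis by (simp only:)
  qed
  then have "cospoly (Suc d) (\<lambda>x. \<Sum>j\<le>d. c j * (cos (2 * pi * x) * cos (2 * pi * real j * x)))"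
    by (intro cospoly_sum cospoly_cmult) auto
  then show ?thesis by (simp add: c sum_distrib_left mult.left_commute)
qed

lemma cospoly_mono: "cospoly d f \<Longrightarrow> d \<le> d' \<Longrightarrow> cospoly d' f"
proof -
  assume "cospoly d f" "d \<le> d'"
  then obtain c where c: "f = (\<lambda>x. \<Sum>j\<le>d. c j * cos (2 * pi * real j * x))"
    by (auto simp: cospoly_def)
  show ?thesis
    unfolding c using \<open>d \<le> d'\<close> by (intro cospoly_sum cospoly_cmult cospoly_cos) auto
qed

lemma cospoly_mult_wt: "cospoly d f \<Longrightarrow> cospoly (d + k) (\<lambda>x. wt x ^ k * f x)"
proof (induction k)
  case (Suc k)
  have "cospoly (Suc (d + k)) (\<lambda>x. 2 / 3 * (wt x ^ k * f x) + - 2 / 3 * (cos (2 * pi * x) * (wt x ^ k * f x)))"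
    using Suc by (intro cospoly_add cospoly_cmult cospoly_mult_cos) (auto intro: cospoly_mono)
  then show ?case by (simp add: wt_def algebra_simps)
qed simp

section \<open>The transfer operator on cosine polynomials\<close>

definition transfer :: "nat \<Rightarrow> (real \<Rightarrow> real) \<Rightarrow> real \<Rightarrow> real" where
  "transfer k f x = wt (x / 2) ^ k * f (x / 2) + wt ((x + 1) / 2) ^ k * f ((x + 1) / 2)"

text \<open>Shifting the argument by 1/2 multiplies the frequency \<open>j\<close> by (-1)^j: odd
  frequencies cancel and even ones are halved.\<close>

lemma cospoly_average_halves:
  assumes "cospoly (2 * d) f"
  shows "cospoly d (\<lambda>x. f (x / 2) + f ((x + 1) / 2))"
proof -
  obtain c where c: "\<And>x. f x = (\<Sum>j\<le>2*d. c j * cos (2 * pi * real j * x))"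
    using assms by (auto simp: cospoly_def)
  have "cospoly d (\<lambda>x. cos (2 * pi * real j * (x / 2)) + cos (2 * pi * real j * ((x + 1) / 2)))"
    if "j \<le> 2 * d" for j
  proof -
    have *: "cos (2 * pi * real j * ((x + 1) / 2)) = (- 1) ^ j * cos (2 * pi * real j * (x / 2))" for x
    proof -
      have "2 * pi * real j * ((x + 1) / 2) = 2 * pi * real j * (x / 2) + real j * pi"
        by (simp add: field_simps)
      then show ?thesis by (simp add: cos_add)
    qed
    show ?thesis
    proof (cases "even j")
      case True
      then obtain i where i: "j = 2 * i" by (auto elim: evenE)
      have "cospoly d (\<lambda>x. 2 * cos (2 * pi * real i * x))"
        using that i by (intro cospoly_cmult cospoly_cos) auto
      also have "(\<lambda>x. 2 * cos (2 * pi * real i * x))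
          = (\<lambda>x. 2 * cos (2 * pi * real j * (x / 2)))"
        by (simp add: i mult_ac)
      finally show ?thesis unfolding * using True by simp
    next
      case False
      then show ?thesis unfolding * using cospoly_const[of d 0] by simp
    qed
  qed
  then have "cospoly d (\<lambda>x. \<Sum>j\<le>2*d. c j *
      (cos (2 * pi * real j * (x / 2)) + cos (2 * pi * real j * ((x + 1) / 2))))"
    by (intro cospoly_sum cospoly_cmult) auto
  then show ?thesis by (simp add: c distrib_left sum.distrib)
qed

text \<open>Multiplying by \<open>wt ^ k\<close> raises the degree from \<open>k\<close> to
  \<open>2 * k\<close>, and the sum over the two preimages halves it again.\<close>

lemma cospoly_transfer:
  assumes "cospoly k f"
  shows "cospoly k (transfer k f)"
proof -
  have "cospoly (2 * k) (\<lambda>x. wt x ^ k * f x)"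
    using cospoly_mult_wt[OF assms, of k] by (simp add: mult_2)
  from cospoly_average_halves[OF this] show ?thesis by (simp add: transfer_def[abs_def])
qed

lemma cospoly_minus: "cospoly d f \<Longrightarrow> f (- x) = f x"
  by (auto simp: cospoly_def)

lemma cospoly_add_1: "cospoly d f \<Longrightarrow> f (x + 1) = f x"
proof -
  have "cos (2 * pi * real j * (x + 1)) = cos (2 * pi * real j * x)" for j
  proof -
    have "2 * pi * real j * (x + 1) = 2 * pi * real j * x + 2 * real j * pi"
      by (simp add: algebra_simps)
    then show ?thesis by (simp add: cos_add)
  qed
  then show "cospoly d f \<Longrightarrow> ?thesis" by (auto simp: cospoly_def)
qed

lemma cospoly_one_minus: "cospoly d f \<Longrightarrow> f (1 - x) = f x"
  using cospoly_add_1[of d f "- x"] cospoly_minus[of d f x] by (simp add: algebra_simps)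

lemma cospoly_continuous: "cospoly d f \<Longrightarrow> continuous_on S f"
proof -
  assume "cospoly d f"
  then obtain c where c: "f = (\<lambda>x. \<Sum>j\<le>d. c j * cos (2 * pi * real j * x))"
    by (auto simp: cospoly_def)
  show ?thesis unfolding c by (intro continuous_intros)
qed

lemma cospoly_integrable: "cospoly d f \<Longrightarrow> f integrable_on {a..b}"
  by (intro integrable_continuous_interval cospoly_continuous)

text \<open>Reflecting the second preimage keeps both branches inside [0, 1/2] when \<open>x\<close>
  lies there.\<close>

lemma cospoly_transfer_eq:
  assumes "cospoly d f"
  shows "transfer k f x = wt (x / 2) ^ k * f (x / 2) + wt ((1 - x) / 2) ^ k * f ((1 - x) / 2)"
proof -
  have "(1 - x) / 2 = 1 - (x + 1) / 2" by (simp add: field_simps)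
  then show ?thesis
    unfolding transfer_def using cospoly_one_minus[OF assms, of "(x + 1) / 2"] wt_one_minus[of "(x + 1) / 2"]
    by (simp only:)
qed

section \<open>Coefficients of nonnegative cosine polynomials\<close>

lemma cospoly_coeff_integral:
  assumes f: "\<And>x. f x = (\<Sum>j\<le>d. c j * cos (2 * pi * real j * x))" and "i \<le> d"
  shows "integral {0..1} (\<lambda>x. f x * cos (2 * pi * real i * x)) = (if i = 0 then c 0 else c i / 2)"
proof -
  have cc: "((\<lambda>x. cos (2 * pi * real j * x) * cos (2 * pi * real i * x)) has_integral
      (if i = j then if i = 0 then 1 else 1 / 2 else 0)) {0..1}" for j
  proof -
    have "((\<lambda>x. 1 / 2 * (cos (2 * pi * (real j - real i) * x) + cos (2 * pi * (real j + real i) * x)))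
      has_integral 1 / 2 * ((if real j - real i = 0 then 1 else 0) + (if real j + real i = 0 then 1 else 0))) {0..1}"
      by (intro has_integral_mult_right has_integral_add cos_2pi_of_int_integral) auto
    also have "(\<lambda>x. 1 / 2 * (cos (2 * pi * (real j - real i) * x) + cos (2 * pi * (real j + real i) * x)))
      = (\<lambda>x. cos (2 * pi * real j * x) * cos (2 * pi * real i * x))"
      by (subst cos_times_cos) (simp add: ring_distribs mult_ac add_divide_distrib)
    also have "1 / 2 * ((if real j - real i = 0 then 1 else 0) + (if real j + real i = 0 then 1 else 0))
      = (if i = j then if i = 0 then 1 else 1 / 2 else (0::real))"
      by auto
    finally show ?thesis .
  qed
  have "((\<lambda>x. \<Sum>j\<le>d. c j * (cos (2 * pi * real j * x) * cos (2 * pi * real i * x))) has_integral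
      (\<Sum>j\<le>d. c j * (if i = j then if i = 0 then 1 else 1 / 2 else 0))) {0..1}"
    by (intro has_integral_sum has_integral_mult_right cc) auto
  also have "(\<lambda>x. \<Sum>j\<le>d. c j * (cos (2 * pi * real j * x) * cos (2 * pi * real i * x)))
      = (\<lambda>x. f x * cos (2 * pi * real i * x))"
    by (simp add: f sum_distrib_right mult.assoc)
  also have "(\<Sum>j\<le>d. c j * (if i = j then if i = 0 then 1 else 1 / 2 else 0))
      = (if i = 0 then c 0 else c i / 2)"
    using \<open>i \<le> d\<close> by (simp add: mult_delta_right)
  finally show ?thesis by (rule integral_unique)
qed

lemma cospoly_integral:
  assumes "\<And>x. f x = (\<Sum>j\<le>d. c j * cos (2 * pi * real j * x))"
  shows "integral {0..1} f = c 0"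
  using cospoly_coeff_integral[OF assms, of 0] by simp

text \<open>For nonnegative \<open>f\<close> the integral of |f cos| is at most that of
  \<open>f\<close>, so the mean alone controls all coefficients.\<close>

lemma cospoly_coeff_bound:
  assumes f: "\<And>x. f x = (\<Sum>j\<le>d. c j * cos (2 * pi * real j * x))" and "i \<le> d"
    and nonneg: "\<And>x. 0 \<le> f x"
  shows "\<bar>c i\<bar> \<le> 2 * integral {0..1} f"
proof -
  have cp: "cospoly d f" using f by (auto simp: cospoly_def)
  have "norm (integral {0..1} (\<lambda>x. f x * cos (2 * pi * real i * x))) \<le> integral {0..1} f"
  proof (rule integral_norm_bound_integral)
    show "(\<lambda>x. f x * cos (2 * pi * real i * x)) integrable_on {0..1}"
      by (intro integrable_continuous_interval continuous_intros cospoly_continuous[OF cp])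
    show "f integrable_on {0..1}" by (rule cospoly_integrable[OF cp])
    show "norm (f x * cos (2 * pi * real i * x)) \<le> f x" if "x \<in> {0..1}" for x
      using nonneg[of x] abs_cos_le_one[of "2 * pi * real i * x"]
      by (simp add: abs_mult mult_left_le)
  qed
  then show ?thesis
    unfolding cospoly_coeff_integral[OF f \<open>i \<le> d\<close>] by (auto split: if_splits)
qed

lemma cospoly_nonneg_le_integral:
  assumes "cospoly d f" "\<And>x. 0 \<le> f x"
  shows "f x \<le> 2 * (d + 1) * integral {0..1} f"
proof -
  obtain c where c: "\<And>x. f x = (\<Sum>j\<le>d. c j * cos (2 * pi * real j * x))"
    using assms(1) by (auto simp: cospoly_def)
  have "f x \<le> (\<Sum>j\<le>d. 2 * integral {0..1} f)"
    unfolding c[of x]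
  proof (rule sum_mono)
    fix j assume "j \<in> {..d}"
    then have "\<bar>c j\<bar> \<le> 2 * integral {0..1} f"
      using cospoly_coeff_bound[OF c _ assms(2)] by simp
    moreover have "\<bar>c j * cos (2 * pi * real j * x)\<bar> \<le> \<bar>c j\<bar> * 1"
      unfolding abs_mult by (intro mult_left_mono) auto
    ultimately show "c j * cos (2 * pi * real j * x) \<le> 2 * integral {0..1} f" by linarith
  qed
  then show ?thesis by (simp add: algebra_simps)
qed

text \<open>Termwise from the coefficient bound: 14 is 2 times 7 with 7 > 2 pi, and there are d + 1
  terms of frequency at most d.\<close>

lemma cospoly_lipschitz:
  assumes "cospoly d f" "\<And>x. 0 \<le> f x"
  shows "\<bar>f x - f y\<bar> \<le> 14 * (d + 1)\<^sup>2 * integral {0..1} f * \<bar>x - y\<bar>"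
proof -
  define I where "I = integral {0..1} f"
  obtain c where c: "\<And>x. f x = (\<Sum>j\<le>d. c j * cos (2 * pi * real j * x))"
    using assms(1) by (auto simp: cospoly_def)
  have "\<bar>f x - f y\<bar> = \<bar>\<Sum>j\<le>d. c j * (cos (2 * pi * real j * x) - cos (2 * pi * real j * y))\<bar>"
    unfolding c[of x] c[of y] by (simp add: right_diff_distrib sum_subtractf)
  also have "\<dots> \<le> (\<Sum>j\<le>d. \<bar>c j * (cos (2 * pi * real j * x) - cos (2 * pi * real j * y))\<bar>)"
    by (rule sum_abs)
  also have "\<dots> \<le> (\<Sum>j\<le>d. 2 * I * (7 * real (d + 1) * \<bar>x - y\<bar>))"
  proof (rule sum_mono)
    fix j assume j: "j \<in> {..d}"
    then have 1: "\<bar>c j\<bar> \<le> 2 * I"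
      using cospoly_coeff_bound[OF c _ assms(2)] by (simp add: I_def)
    have "\<bar>cos (2 * pi * real j * x) - cos (2 * pi * real j * y)\<bar> \<le> \<bar>2 * pi * real j * x - 2 * pi * real j * y\<bar>"
      by (rule cos_lipschitz)
    also have "\<dots> = 2 * pi * real j * \<bar>x - y\<bar>"
      by (simp add: right_diff_distrib[symmetric] abs_mult)
    also have "\<dots> \<le> 7 * real (d + 1) * \<bar>x - y\<bar>"
      using j pi_approx by (intro mult_right_mono mult_mono) auto
    finally show "\<bar>c j * (cos (2 * pi * real j * x) - cos (2 * pi * real j * y))\<bar>
        \<le> 2 * I * (7 * real (d + 1) * \<bar>x - y\<bar>)"
      unfolding abs_mult using 1 by (intro mult_mono) auto
  qed
  also have "\<dots> = 14 * (d + 1)\<^sup>2 * I * \<bar>x - y\<bar>"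
    by (simp add: power2_eq_square algebra_simps)
  finally show ?thesis by (simp add: I_def)
qed

section \<open>Existence of an eigenfunction\<close>

lemma integral_split_halves:
  fixes h :: "real \<Rightarrow> real"
  assumes "continuous_on UNIV h"
  shows "integral {0..1} h = 1 / 2 * integral {0..1} (\<lambda>x. h (x / 2) + h ((x + 1) / 2))"
proof -
  have int: "h integrable_on {a..b}" for a b
    using assms by (intro integrable_continuous_interval) (auto intro: continuous_on_subset)
  have *: "((\<lambda>x. h (x / 2 + c)) has_integral (2 * integral {c..c+1/2} h)) {0..1}" for c
  proof -
    have "(h has_integral (integral {c..c+1/2} h)) (cbox c (c + 1/2))"
      using int by (simp add: integrable_integral)
    moreover have "(\<lambda>x. x * 2 - c * 2) ` {c..c+1/2} = {0..1}"
      using image_affinity_atLeastAtMost[of 2 "- 2 * c" c "c + 1 / 2"] by (simp add: mult.commute)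
    ultimately show ?thesis
      using has_integral_affinity[of h "integral {c..c+1/2} h" c "c + 1 / 2" "1 / 2" c]
      by (simp add: algebra_simps)
  qed
  have "((\<lambda>x. h (x / 2) + h ((x + 1) / 2)) has_integral
      (2 * integral {0..1/2} h + 2 * integral {1/2..1} h)) {0..1}"
    using has_integral_add[OF *[of 0] *[of "1/2"]] by (simp add: add_divide_distrib)
  moreover have "integral {0..1/2} h + integral {1/2..1} h = integral {0..1} h"
    using int by (intro Henstock_Kurzweil_Integration.integral_combine) auto
  ultimately show ?thesis by (simp add: integral_unique)
qed

lemma e_add_of_nat: "e (x + real m) = e x"
proof -
  have "2 * of_real pi * \<i> * of_real (x + real m) = 2 * of_real pi * \<i> * of_real x + 2 * of_int (int m) * of_real pi * \<i>"
    by (simp add: algebra_simps)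
  then show ?thesis unfolding e_def by (auto simp: exp_add exp_eq_1 intro!: exI[of _ "int m"])
qed

lemma norm_one_minus_e: "(cmod (1 - e x))\<^sup>2 = 3 * wt x"
proof -
  have "e x = cis (2 * pi * x)"
    by (simp add: e_def cis_conv_exp mult_ac)
  then have "(cmod (1 - e x))\<^sup>2 = (1 - cos (2 * pi * x))\<^sup>2 + (sin (2 * pi * x))\<^sup>2"
    by (simp add: cmod_power2)
  also have "\<dots> = 3 * wt x"
    using sin_cos_squared_add[of "2 * pi * x"] by (simp add: wt_def power2_eq_square algebra_simps)
  finally show ?thesis .
qed

lemma T_add_1: "T n (x + 1) = T n x"
proof -
  have "e (2 ^ r * (x + 1)) = e (2 ^ r * x)" for r
    using e_add_of_nat[of "2 ^ r * x" "2 ^ r"] by (simp add: distrib_left)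
  then show ?thesis by (simp add: T_def)
qed

lemma T_Suc: "T (Suc n) x = (1 - e x) * T n (2 * x)"
  unfolding T_def prod.lessThan_Suc_shift by (simp add: mult_ac)

lemma continuous_on_T: "continuous_on S (T n)"
  unfolding T_def[abs_def] e_def by (intro continuous_intros)

text \<open>Peeling off the factor \<open>1 - e x\<close> and substituting \<open>x / 2\<close>
  replaces \<open>f\<close> by \<open>transfer k f\<close>, hence the induction over all
  \<open>f\<close>. Each step contributes 3^k from |1 - e|^2 = 3 wt and 1/2 from the
  substitution.\<close>

lemma integral_T_transfer:
  assumes "cospoly k f"
  shows "integral {0..1} (\<lambda>x. cmod (T n x) ^ (2 * k) * f x)
    = (3 ^ k / 2) ^ n * integral {0..1} ((transfer k ^^ n) f)"
  using assms
proof (induction n arbitrary: f)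
  case 0
  then show ?case by (simp add: T_def)
next
  case (Suc n)
  have W: "cmod (T (Suc n) x) ^ (2 * k) = 3 ^ k * wt x ^ k * cmod (T n (2 * x)) ^ (2 * k)" for x
  proof -
    have "cmod (1 - e x) ^ (2 * k) = (3 * wt x) ^ k"
      by (simp only: power_mult norm_one_minus_e)
    then show ?thesis by (simp add: T_Suc norm_mult power_mult_distrib)
  qed
  have "integral {0..1} (\<lambda>x. cmod (T (Suc n) x) ^ (2 * k) * f x) = 1 / 2 * integral {0..1}
    (\<lambda>x. cmod (T (Suc n) (x / 2)) ^ (2 * k) * f (x / 2) + cmod (T (Suc n) ((x + 1) / 2)) ^ (2 * k) * f ((x + 1) / 2))"
    by (rule integral_split_halves)
       (intro continuous_intros continuous_on_T cospoly_continuous[OF Suc.prems])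
  also have "(\<lambda>x. cmod (T (Suc n) (x / 2)) ^ (2 * k) * f (x / 2) + cmod (T (Suc n) ((x + 1) / 2)) ^ (2 * k) * f ((x + 1) / 2))
    = (\<lambda>x. 3 ^ k * (cmod (T n x) ^ (2 * k) * transfer k f x))"
  proof
    fix x :: real
    have "2 * ((x + 1) / 2) = x + 1" "2 * (x / 2) = x" by simp_all
    then show "cmod (T (Suc n) (x / 2)) ^ (2 * k) * f (x / 2) + cmod (T (Suc n) ((x + 1) / 2)) ^ (2 * k) * f ((x + 1) / 2)
      = 3 ^ k * (cmod (T n x) ^ (2 * k) * transfer k f x)"
      unfolding W transfer_def by (simp only: T_add_1) (simp add: algebra_simps)
  qed
  also have "1 / 2 * integral {0..1} \<dots>
      = 3 ^ k / 2 * integral {0..1} (\<lambda>x. cmod (T n x) ^ (2 * k) * transfer k f x)"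
    by simp
  also have "\<dots> = (3 ^ k / 2) ^ Suc n * integral {0..1} ((transfer k ^^ Suc n) f)"
    by (simp add: Suc.IH[OF cospoly_transfer[OF Suc.prems]] funpow_swap1)
  finally show ?case .
qed

lemma M_eq: "M k n = (3 ^ k / 2) ^ n * integral {0..1} ((transfer k ^^ n) (\<lambda>_. 1))"
  using integral_T_transfer[OF cospoly_const[of k 1], of n] by (simp add: M_def)

lemma transfer_nonneg: "(\<And>x. 0 \<le> f x) \<Longrightarrow> 0 \<le> transfer k f x"
  by (simp add: transfer_def)

lemma transfer_sum: "transfer k (\<lambda>x. \<Sum>i\<in>A. f i x) x = (\<Sum>i\<in>A. transfer k (f i) x)"
  by (simp add: transfer_def sum_distrib_left sum.distrib)

lemma transfer_cmult: "transfer k (\<lambda>x. a * f x) x = a * transfer k f x"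
  by (simp add: transfer_def algebra_simps)

lemma cospoly_transfer_funpow: "cospoly k ((transfer k ^^ n) (\<lambda>_. 1))"
  by (induction n) (auto intro: cospoly_const cospoly_transfer)

lemma transfer_funpow_nonneg: "0 \<le> (transfer k ^^ n) (\<lambda>_. 1) x"
  by (induction n arbitrary: x) (auto intro: transfer_nonneg)

lemma transfer_one_third:
  assumes "cospoly k f"
  shows "transfer k f (1 / 3) = f (1 / 3) + (1 / 3) ^ k * f (1 / 6)"
proof -
  have "wt (1 / 6) = 1 / 3"
    using wt_hom_Suc[of 0] by (simp add: hom_1 hcos_0)
  moreover have "transfer k f (1 / 3) = wt (1 / 6) ^ k * f (1 / 6) + wt (1 / 3) ^ k * f (1 / 3)"
    using cospoly_transfer_eq[OF assms, where x = "1 / 3"] by simp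
  ultimately show ?thesis by (simp only: wt_one_third) simp
qed

text \<open>At the fixed point 1/3 of weight 1 the iterates never drop below 1, and a point value of
  a nonnegative cosine polynomial bounds its mean from below.\<close>

lemma integral_transfer_funpow_ge: "1 / (2 * (real k + 1)) \<le> integral {0..1} ((transfer k ^^ n) (\<lambda>_. 1))"
proof -
  have "1 \<le> (transfer k ^^ n) (\<lambda>_. 1) (1 / 3)"
  proof (induction n)
    case (Suc n)
    have "0 \<le> (1 / 3) ^ k * (transfer k ^^ n) (\<lambda>_. 1) (1 / 6)"
      by (intro mult_nonneg_nonneg transfer_funpow_nonneg) auto
    then show ?case using Suc by (simp add: transfer_one_third[OF cospoly_transfer_funpow])
  qed simp
  also have "\<dots> \<le> 2 * (real k + 1) * integral {0..1} ((transfer k ^^ n) (\<lambda>_. 1))"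
    using cospoly_nonneg_le_integral[OF cospoly_transfer_funpow transfer_funpow_nonneg]
    by (simp add: add.commute)
  finally show ?thesis by (simp add: divide_le_eq mult.commute)
qed

text \<open>For \<open>\<mu> < 1\<close> the integrals would tend to 0, against their uniform lower
  bound.\<close>

lemma growth_ge_1:
  assumes "(\<lambda>n. integral {0..1} ((transfer k ^^ n) (\<lambda>_. 1)) / \<mu> ^ n) \<longlonglongrightarrow> C" "0 < \<mu>"
  shows "1 \<le> \<mu>"
proof (rule ccontr)
  assume "\<not> 1 \<le> \<mu>"
  then have "(\<lambda>n. \<mu> ^ n) \<longlonglongrightarrow> 0"
    using assms(2) by (intro LIMSEQ_realpow_zero) auto
  from tendsto_mult[OF assms(1) this]
  have "(\<lambda>n. integral {0..1} ((transfer k ^^ n) (\<lambda>_. 1))) \<longlonglongrightarrow> 0"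
    using assms(2) by simp
  then have "1 / (2 * (real k + 1)) \<le> 0"
    by (rule tendsto_lowerbound) (intro always_eventually allI integral_transfer_funpow_ge, simp)
  then show False by (simp add: divide_le_0_iff)
qed

text \<open>Bolzano-Weierstrass one coordinate at a time; it is applied to the coefficient vectors
  of the Cesaro means.\<close>

lemma finitely_many_convergent_subsequences:
  fixes c :: "nat \<Rightarrow> nat \<Rightarrow> real"
  assumes "\<And>n j. j < d \<Longrightarrow> \<bar>c n j\<bar> \<le> B"
  shows "\<exists>r l. strict_mono r \<and> (\<forall>j<d. (\<lambda>n. c (r n) j) \<longlonglongrightarrow> l j)"
  using assms
proof (induction d)
  case 0
  show ?case using strict_mono_id by blast
next
  case (Suc d)
  then obtain r l where r: "strict_mono r" "\<And>j. j < d \<Longrightarrow> (\<lambda>n. c (r n) j) \<longlonglongrightarrow> l j"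
    by (metis less_SucI)
  have "bounded (range (\<lambda>n. c (r n) d))"
    using Suc.prems[of d] by (auto simp: bounded_iff)
  then obtain m s where s: "strict_mono s" "((\<lambda>n. c (r n) d) \<circ> s) \<longlonglongrightarrow> m"
    using bounded_imp_convergent_subsequence by blast
  have "(\<lambda>n. c ((r \<circ> s) n) j) \<longlonglongrightarrow> (l(d := m)) j" if "j < Suc d" for j
    using that LIMSEQ_subseq_LIMSEQ[OF r(2)[of j] s(1)] s(2) by (cases "j = d") (auto simp: o_def)
  moreover have "strict_mono (r \<circ> s)" using r(1) s(1) by (rule strict_mono_o)
  ultimately show ?case by blast
qed

text \<open>A limit point of the Cesaro means of the normalised iterates of the constant function 1.\<close>

lemma eigenfunction_exists:
  assumes lim: "(\<lambda>n. integral {0..1} ((transfer k ^^ n) (\<lambda>_. 1)) / \<mu> ^ n) \<longlonglongrightarrow> C"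
    and "0 < C" "0 < \<mu>"
  shows "\<exists>f. cospoly k f \<and> (\<forall>x. 0 \<le> f x) \<and> 0 < integral {0..1} f \<and> (\<forall>x. transfer k f x = \<mu> * f x)"
proof -
  define g where "g n x = (transfer k ^^ n) (\<lambda>_. 1) x / \<mu> ^ n" for n x
  have g_cp: "cospoly k (g n)" for n
    using cospoly_cmult[OF cospoly_transfer_funpow, where a = "1 / \<mu> ^ n"] by (simp add: g_def[abs_def])
  have g_nonneg: "0 \<le> g n x" for n x
    using assms(3) by (simp add: g_def transfer_funpow_nonneg)
  have g_int: "integral {0..1} (g n) = integral {0..1} ((transfer k ^^ n) (\<lambda>_. 1)) / \<mu> ^ n" for n
    by (simp add: g_def[abs_def])
  have g_transfer: "transfer k (g n) x = \<mu> * g (Suc n) x" for n x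
    using transfer_cmult[where a = "1 / \<mu> ^ n" and f = "(transfer k ^^ n) (\<lambda>_. 1)"] assms(3)
    by (simp add: g_def[abs_def])
  have g_lim: "(\<lambda>n. integral {0..1} (g n)) \<longlonglongrightarrow> C"
    using lim by (simp add: g_int)
  have g_pos: "0 < integral {0..1} (g n)" for n
    using integral_transfer_funpow_ge[of k n] assms(3)
    by (auto simp: g_int intro!: divide_pos_pos less_le_trans[OF _ integral_transfer_funpow_ge[of k n]])
  obtain B where B: "\<And>n. integral {0..1} (g n) \<le> B"
    using Bseq_def convergent_imp_Bseq[OF convergentI[OF g_lim]]
    by (metis abs_le_D1 real_norm_def)
  obtain n0 where n0: "\<And>n. n \<ge> n0 \<Longrightarrow> C / 2 < integral {0..1} (g n)"
    using order_tendstoD(1)[OF g_lim, of "C / 2"] assms(2) by (auto simp: eventually_sequentially)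
  \<comment> \<open>A positive lower bound for all the means: the limit \<open>C\<close> covers
    large indices, the minimum the finitely many others. It keeps the limit function from being
    zero.\<close>
  define b where "b = Min (insert (C / 2) ((\<lambda>n. integral {0..1} (g n)) ` {..<n0}))"
  have b_pos: "0 < b" using assms(2) g_pos by (auto simp: b_def)
  have b: "b \<le> integral {0..1} (g n)" for n
  proof (cases "n < n0")
    case False
    have "b \<le> C / 2" unfolding b_def by (intro Min_le) auto
    also have "\<dots> \<le> integral {0..1} (g n)" using n0 False by (simp add: less_imp_le)
    finally show ?thesis .
  qed (auto simp: b_def intro: Min_le)

  define F where "F N x = (\<Sum>n<Suc N. 1 / real (Suc N) * g n x)" for N x
  have F_cp: "cospoly k (F N)" for N
    unfolding F_def[abs_def] by (intro cospoly_sum cospoly_cmult g_cp)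
  have F_nonneg: "0 \<le> F N x" for N x
    unfolding F_def by (intro sum_nonneg mult_nonneg_nonneg g_nonneg) auto
  have F_int: "integral {0..1} (F N) = (\<Sum>n<Suc N. 1 / real (Suc N) * integral {0..1} (g n))" for N
    unfolding F_def[abs_def]
    by (subst integral_sum) (auto intro!: integrable_on_cmult_left cospoly_integrable[OF g_cp] cospoly_integrable[OF cospoly_cmult[OF g_cp]] simp del: of_nat_Suc)
  have F_int_le: "integral {0..1} (F N) \<le> B" for N
  proof -
    have "integral {0..1} (F N) \<le> (\<Sum>n<Suc N. 1 / real (Suc N) * B)"
      unfolding F_int by (intro sum_mono mult_left_mono B) auto
    then show ?thesis by simp
  qed
  have F_int_ge: "b \<le> integral {0..1} (F N)" for N
  proof -
    have "(\<Sum>n<Suc N. 1 / real (Suc N) * b) \<le> integral {0..1} (F N)"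
      unfolding F_int by (intro sum_mono mult_left_mono b) auto
    then show ?thesis by simp
  qed
  \<comment> \<open>The defect from being an eigenfunction telescopes, so it is O(1/N).\<close>
  have F_transfer: "transfer k (F N) x - \<mu> * F N x = \<mu> * (g (Suc N) x - g 0 x) / real (Suc N)" for N x
  proof -
    have "transfer k (F N) x - \<mu> * F N x = (\<Sum>n<Suc N. \<mu> / real (Suc N) * (g (Suc n) x - g n x))"
      unfolding F_def[abs_def] transfer_sum transfer_cmult g_transfer
      by (simp add: sum_distrib_left sum_subtractf[symmetric] algebra_simps del: sum.lessThan_Suc of_nat_Suc)
    also have "\<dots> = \<mu> / real (Suc N) * (g (Suc N) x - g 0 x)"
      unfolding sum_distrib_left[symmetric] using sum_lessThan_telescope[of "\<lambda>n. g n x" "Suc N"]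
      by (simp only:)
    finally show ?thesis by simp
  qed

  obtain c where c: "\<And>N x. F N x = (\<Sum>j\<le>k. c N j * cos (2 * pi * real j * x))"
    using F_cp unfolding cospoly_def by metis
  have "\<bar>c N j\<bar> \<le> 2 * B" if "j < Suc k" for N j
    using cospoly_coeff_bound[OF c _ F_nonneg, of j N] F_int_le[of N] that by simp
  then obtain r l where r: "strict_mono r" "\<And>j. j < Suc k \<Longrightarrow> (\<lambda>N. c (r N) j) \<longlonglongrightarrow> l j"
    using finitely_many_convergent_subsequences[of "Suc k" c "2 * B"] by blast
  define f where "f x = (\<Sum>j\<le>k. l j * cos (2 * pi * real j * x))" for x
  have F_lim: "(\<lambda>N. F (r N) x) \<longlonglongrightarrow> f x" for x
    unfolding c f_def by (intro tendsto_intros r(2)) auto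
  have "cospoly k f" unfolding cospoly_def f_def by blast
  moreover have "0 \<le> f x" for x
    by (rule tendsto_lowerbound[OF F_lim]) (auto intro: always_eventually F_nonneg)
  \<comment> \<open>The integral is the coefficient of frequency 0, so the lower bound
    \<open>b\<close> passes to the limit.\<close>
  moreover have "0 < integral {0..1} f"
  proof -
    have "b \<le> c N 0" for N
      using F_int_ge[of N] cospoly_integral[OF c, of N] by simp
    then have "b \<le> l 0"
      by (intro tendsto_lowerbound[OF r(2)[of 0]]) auto
    then show ?thesis using b_pos cospoly_integral[OF f_def] by simp
  qed
  moreover have "transfer k f x = \<mu> * f x" for x
  proof -
    have "(\<lambda>N. transfer k (F (r N)) x - \<mu> * F (r N) x) \<longlonglongrightarrow> transfer k f x - \<mu> * f x"
      unfolding transfer_def by (intro tendsto_intros F_lim)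
    moreover have "(\<lambda>N. transfer k (F N) x - \<mu> * F N x) \<longlonglongrightarrow> 0"
    proof (rule tendsto_0_le[where K = 1])
      define D where "D = 2 * (real k + 1) * B"
      have gD: "g n x \<le> D" for n
      proof -
        have "g n x \<le> 2 * (k + 1) * integral {0..1} (g n)"
          by (rule cospoly_nonneg_le_integral[OF g_cp g_nonneg])
        also have "\<dots> \<le> D"
          using B[of n] unfolding D_def by (intro mult_mono) (auto simp: less_imp_le[OF g_pos])
        finally show ?thesis .
      qed
      show "\<forall>\<^sub>F N in sequentially. norm (transfer k (F N) x - \<mu> * F N x) \<le> norm (\<mu> * D / real (Suc N)) * 1"
      proof (intro always_eventually allI)
        fix N
        have "\<bar>g (Suc N) x - g 0 x\<bar> \<le> \<bar>D\<bar>"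
          using gD[of 0] gD[of "Suc N"] g_nonneg[of 0 x] g_nonneg[of "Suc N" x] by linarith
        then show "norm (transfer k (F N) x - \<mu> * F N x) \<le> norm (\<mu> * D / real (Suc N)) * 1"
          unfolding F_transfer using assms(3)
          by (simp add: abs_mult divide_right_mono mult_left_mono del: of_nat_Suc)
      qed
      show "(\<lambda>N. \<mu> * D / real (Suc N)) \<longlonglongrightarrow> 0"
        by (rule LIMSEQ_Suc[OF lim_const_over_n])
    qed
    then have "(\<lambda>N. transfer k (F (r N)) x - \<mu> * F (r N) x) \<longlonglongrightarrow> 0"
      using LIMSEQ_subseq_LIMSEQ[OF _ r(1)] by (force simp: o_def)
    ultimately show ?thesis using LIMSEQ_unique by fastforce
  qed
  ultimately show ?thesis by blast
qed

section \<open>Estimates for the eigenfunction\<close>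

text \<open>With the exponent 1/3, \<open>(wt y)\<^sup>2 * wt (2 * y) \<le> 1\<close> yields
  \<open>wt y * wt_cbrt (2 * y) \<le> wt_cbrt y\<close>, the form compatible with one transfer
  step.\<close>

definition wt_cbrt :: "real \<Rightarrow> real" where
  "wt_cbrt x = root 3 (wt x)"

lemma wt_cbrt_nonneg [simp]: "0 \<le> wt_cbrt x"
  by (simp add: wt_cbrt_def)

lemma wt_cbrt_cubed: "wt_cbrt x ^ 3 = wt x"
  by (simp add: wt_cbrt_def)

lemma wt_cbrt_sq_cubed: "((wt_cbrt x)\<^sup>2) ^ 3 = (wt x)\<^sup>2"
  by (metis wt_cbrt_cubed mult.commute power_mult)

lemma cube_le_cubeD: "a ^ 3 \<le> b ^ 3 \<Longrightarrow> 0 \<le> b \<Longrightarrow> a \<le> b" for a b :: real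
  using power_le_imp_le_base[of a 2 b] by (simp add: numeral_3_eq_3)

lemma wt_cbrt_one_minus [simp]: "wt_cbrt (1 - x) = wt_cbrt x"
  by (simp add: wt_cbrt_def)

lemma wt_cbrt_one_third [simp]: "wt_cbrt (1 / 3) = 1"
  by (simp add: wt_cbrt_def)

lemma continuous_on_wt_cbrt: "continuous_on S wt_cbrt"
  unfolding wt_cbrt_def[abs_def] wt_def[abs_def] by (intro continuous_intros)

lemma wt_sq_wt_double: "(wt y)\<^sup>2 * wt (2 * y) = 16 / 27 * ((1 - cos (2 * pi * y)) ^ 3 * (1 + cos (2 * pi * y)))"
proof -
  have "cos (2 * pi * (2 * y)) = 2 * (cos (2 * pi * y))\<^sup>2 - 1"
    using cos_double_cos[of "2 * pi * y"] by (simp add: mult_ac)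
  then have "wt (2 * y) = 2 / 3 * (1 - (2 * (cos (2 * pi * y))\<^sup>2 - 1))"
    by (simp only: wt_def)
  moreover have "(2 / 3 * (1 - z))\<^sup>2 * (2 / 3 * (1 - (2 * z\<^sup>2 - 1))) = 16 / 27 * ((1 - z) ^ 3 * (1 + z))" for z :: real
    by (simp add: field_simps power2_eq_square power3_eq_cube)
  ultimately show ?thesis by (simp only: wt_def)
qed

lemma wt_cbrt_sq_wt_cbrt_double_le_1: "(wt_cbrt y)\<^sup>2 * wt_cbrt (2 * y) \<le> 1"
proof -
  define u where "u = 1 - cos (2 * pi * y)"
  \<comment> \<open>This product equals 27 - 16 u^3 (2 - u). It vanishes at u = 3/2, which
    corresponds to y = 1/3.\<close>
  have "0 \<le> (2 * u - 3)\<^sup>2 * ((2 * u + 1)\<^sup>2 + 2)"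
    by (intro mult_nonneg_nonneg) auto
  then have "16 / 27 * (u ^ 3 * (2 - u)) \<le> 1"
    by (simp add: algebra_simps power2_eq_square power3_eq_cube)
  then have "(wt y)\<^sup>2 * wt (2 * y) \<le> 1"
    unfolding wt_sq_wt_double by (simp add: u_def)
  then have "((wt_cbrt y)\<^sup>2 * wt_cbrt (2 * y)) ^ 3 \<le> 1 ^ 3"
    by (simp only: power_mult_distrib wt_cbrt_cubed wt_cbrt_sq_cubed) simp
  then show ?thesis by (rule cube_le_cubeD) simp
qed

text \<open>Here the cosine is nonnegative, so u <= 1 and the cubed product is at most 16/27 <
  0.85^3. This is the strict gain on the branch \<open>x / 2\<close>.\<close>

lemma wt_cbrt_sq_wt_cbrt_double_le:
  assumes "0 \<le> y" "y \<le> 1 / 4"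
  shows "(wt_cbrt y)\<^sup>2 * wt_cbrt (2 * y) \<le> 0.85"
proof -
  define u where "u = 1 - cos (2 * pi * y)"
  have "2 * pi * y \<le> pi / 2" using assms pi_gt_zero by (simp add: field_simps)
  then have "0 \<le> cos (2 * pi * y)" using assms pi_gt_zero
    by (intro cos_ge_zero) (auto intro: order.trans[of _ 0])
  then have u: "0 \<le> u" "u \<le> 1" by (auto simp: u_def)
  have "u\<^sup>2 * (u * (2 - u)) \<le> 1 * 1"
  proof (rule mult_mono)
    show "u\<^sup>2 \<le> 1" using u by (simp add: power_le_one)
    have "0 \<le> (u - 1)\<^sup>2" by simp
    then show "u * (2 - u) \<le> 1" by (simp add: power2_eq_square algebra_simps)
  qed (use u in auto)
  have "(wt y)\<^sup>2 * wt (2 * y) \<le> 16 / 27"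
  proof -
    have "(1 - cos (2 * pi * y)) ^ 3 * (1 + cos (2 * pi * y)) = u\<^sup>2 * (u * (2 - u))"
      by (simp add: u_def power2_eq_square power3_eq_cube)
    then show ?thesis using \<open>u\<^sup>2 * (u * (2 - u)) \<le> 1 * 1\<close> unfolding wt_sq_wt_double by linarith
  qed
  also have "\<dots> \<le> 0.85 ^ 3" by (simp add: power3_eq_cube)
  finally have "((wt_cbrt y)\<^sup>2 * wt_cbrt (2 * y)) ^ 3 \<le> 0.85 ^ 3"
    by (simp only: power_mult_distrib wt_cbrt_cubed wt_cbrt_sq_cubed)
  then show ?thesis by (rule cube_le_cubeD) simp
qed

lemma wt_cbrt_sq_le:
  assumes "(wt y)\<^sup>2 \<le> c ^ 3" "0 \<le> c"
  shows "(wt_cbrt y)\<^sup>2 \<le> c"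
proof -
  have "((wt_cbrt y)\<^sup>2) ^ 3 \<le> c ^ 3" using assms by (simp only: wt_cbrt_sq_cubed)
  then show ?thesis using assms(2) by (rule cube_le_cubeD)
qed

lemma one_minus_half_iterate_dist: "\<bar>((\<lambda>x. (1 - x) / 2) ^^ n) x - 1 / 3\<bar> = (1 / 2) ^ n * \<bar>x - 1 / 3\<bar>" for x :: real
proof (induction n)
  case (Suc n)
  define y where "y = ((\<lambda>x. (1 - x) / 2) ^^ n) x"
  have "(1 - y) / 2 - 1 / 3 = - 1 / 2 * (y - 1 / 3)" by (simp add: field_simps)
  then have "\<bar>(1 - y) / 2 - 1 / 3\<bar> = 1 / 2 * \<bar>y - 1 / 3\<bar>" by (simp add: abs_mult)
  then show ?case using Suc by (simp add: y_def)
qed simp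

lemma one_minus_half_iterate_range:
  "x \<in> {0..1/2} \<Longrightarrow> ((\<lambda>x. (1 - x) / 2) ^^ n) x \<in> {0..1/2}" for x :: real
  by (induction n) auto

lemma wt_hom_1: "wt (hom 1) = 1 / 3"
  using wt_hom_Suc[of 0] by (simp add: hcos_0)

lemma Q_1: "Q (Suc 0) = 1 / 3"
  using wt_hom_1 by (simp add: Q_def)

section \<open>Weighted bounds for a nonnegative eigenfunction\<close>

locale eigenfunction =
  fixes k :: nat and \<mu> :: real and f :: "real \<Rightarrow> real"
  assumes cp: "cospoly k f"
    and nonneg: "\<And>x. 0 \<le> f x"
    and int_pos: "0 < integral {0..1} f"
    and eig: "\<And>x. transfer k f x = \<mu> * f x"
    and mu: "1 \<le> \<mu>"
begin

lemma f_eq: "\<mu> * f x = wt (x / 2) ^ k * f (x / 2) + wt ((1 - x) / 2) ^ k * f ((1 - x) / 2)"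
  using eig[of x] cospoly_transfer_eq[OF cp, where x = x] by simp

lemma f_le: "f x \<le> wt (x / 2) ^ k * f (x / 2) + wt ((1 - x) / 2) ^ k * f ((1 - x) / 2)"
proof -
  have "1 * f x \<le> \<mu> * f x" using mu nonneg by (intro mult_right_mono) auto
  then show ?thesis by (simp add: f_eq)
qed

definition R :: "real \<Rightarrow> real" where
  "R x = f x * wt_cbrt x ^ k"

definition Rmax :: real where
  "Rmax = Sup (R ` {0..1/2})"

lemma R_nonneg: "0 \<le> R x"
  by (simp add: R_def nonneg)

lemma continuous_on_R: "continuous_on S R"
  unfolding R_def[abs_def] by (intro continuous_intros continuous_on_wt_cbrt cospoly_continuous[OF cp])

lemma R_attains: "\<exists>x\<in>{0..1/2}. R x = Rmax"
  and R_le_Rmax: "y \<in> {0..1/2} \<Longrightarrow> R y \<le> Rmax"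
proof -
  obtain x where x: "x \<in> {0..1/2}" "\<And>y. y \<in> {0..1/2} \<Longrightarrow> R y \<le> R x"
    using continuous_attains_sup[of "{0..1/2}" R] continuous_on_R by auto
  then have "Rmax = R x"
    unfolding Rmax_def by (intro cSup_eq_maximum) auto
  then show "\<exists>x\<in>{0..1/2}. R x = Rmax" "y \<in> {0..1/2} \<Longrightarrow> R y \<le> Rmax"
    using x by auto
qed

lemma Rmax_nonneg: "0 \<le> Rmax"
  using R_attains R_nonneg by metis

text \<open>Of the three cube roots in \<open>wt\<close>, one is absorbed into \<open>R\<close> and
  two remain; this avoids dividing by \<open>wt_cbrt\<close>, which vanishes at 0.\<close>

lemma wt_f_eq: "wt y ^ k * f y = ((wt_cbrt y)\<^sup>2) ^ k * R y"
proof -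
  have "wt y = (wt_cbrt y)\<^sup>2 * wt_cbrt y" by (simp add: power2_eq_square flip: wt_cbrt_cubed power3_eq_cube)
  then show ?thesis by (simp add: R_def power_mult_distrib)
qed

text \<open>Turns a bound on the weight of a branch into its exponential rate \<open>c\<close>;
  cubing the hypothesis keeps it rational.\<close>

lemma wt_f_le:
  assumes "y \<in> {0..1/2}" "(wt y)\<^sup>2 \<le> c ^ 3" "0 \<le> c"
  shows "wt y ^ k * f y \<le> c ^ k * Rmax"
  unfolding wt_f_eq using assms
  by (intro mult_mono power_mono wt_cbrt_sq_le R_le_Rmax R_nonneg) auto

text \<open>The weight \<open>wt_cbrt ^ k\<close> makes the branch \<open>(1 - x) / 2\<close>, which contracts to \<open>1/3\<close>, nonexpanding and
  the other branch exponentially small in \<open>k\<close>.\<close>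

lemma R_branches:
  assumes "x \<in> {0..1/2}"
  shows "R x \<le> 0.85 ^ k * Rmax + R ((1 - x) / 2)"
proof -
  have 1: "wt (x / 2) ^ k * f (x / 2) * wt_cbrt x ^ k \<le> 0.85 ^ k * Rmax"
  proof -
    have "wt (x / 2) ^ k * f (x / 2) * wt_cbrt x ^ k = ((wt_cbrt (x / 2))\<^sup>2 * wt_cbrt (2 * (x / 2))) ^ k * R (x / 2)"
      unfolding wt_f_eq by (simp add: power_mult_distrib)
    also have "\<dots> \<le> 0.85 ^ k * Rmax"
      using assms by (intro mult_mono power_mono wt_cbrt_sq_wt_cbrt_double_le R_le_Rmax R_nonneg) auto
    finally show ?thesis .
  qed
  have 2: "wt ((1 - x) / 2) ^ k * f ((1 - x) / 2) * wt_cbrt x ^ k \<le> R ((1 - x) / 2)"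
  proof -
    define y where "y = (1 - x) / 2"
    have "2 * y = 1 - x" by (simp add: y_def)
    then have "wt_cbrt x = wt_cbrt (2 * y)" by simp
    then have "wt y ^ k * f y * wt_cbrt x ^ k = ((wt_cbrt y)\<^sup>2 * wt_cbrt (2 * y)) ^ k * R y"
      unfolding wt_f_eq by (simp add: power_mult_distrib)
    also have "\<dots> \<le> 1 ^ k * R y"
      by (intro mult_right_mono power_mono wt_cbrt_sq_wt_cbrt_double_le_1 R_nonneg) auto
    finally show ?thesis by (simp add: y_def)
  qed
  have "R x \<le> (wt (x / 2) ^ k * f (x / 2) + wt ((1 - x) / 2) ^ k * f ((1 - x) / 2)) * wt_cbrt x ^ k"
    unfolding R_def by (intro mult_right_mono f_le) auto
  then show ?thesis using 1 2 by (simp add: distrib_right)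
qed

lemma R_iterate:
  assumes "x \<in> {0..1/2}"
  shows "R x \<le> real n * 0.85 ^ k * Rmax + R (((\<lambda>x. (1 - x) / 2) ^^ n) x)"
proof (induction n)
  case (Suc n)
  then show ?case
    using R_branches[OF one_minus_half_iterate_range[OF assms, of n]] by (simp add: algebra_simps)
qed simp

text \<open>As \<open>wt_cbrt\<close> vanishes at 0, \<open>R \<le> Rmax\<close> alone does not
  bound \<open>f\<close> there. One use of the eigenvalue inequality restores a factor
  \<open>wt ^ k\<close>, and \<open>wt\<close> is at most 4/3.\<close>

lemma f_le_Rmax:
  assumes "x \<in> {0..1}"
  shows "f x \<le> 2 * (4 / 3) ^ k * Rmax"
proof -
  have *: "f x \<le> 2 * (4 / 3) ^ k * Rmax" if "x \<in> {0..1/2}" for x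
  proof -
    have w: "(wt y)\<^sup>2 \<le> (4 / 3) ^ 3" for y
    proof -
      have "(wt y)\<^sup>2 \<le> (4 / 3)\<^sup>2" using wt_le[of y] by (intro power_mono) auto
      also have "\<dots> \<le> (4 / 3) ^ 3" by (intro power_increasing) auto
      finally show ?thesis .
    qed
    have "wt (x / 2) ^ k * f (x / 2) \<le> (4 / 3) ^ k * Rmax"
      "wt ((1 - x) / 2) ^ k * f ((1 - x) / 2) \<le> (4 / 3) ^ k * Rmax"
      using that by (intro wt_f_le w; simp)+
    then show ?thesis using f_le[of x] by linarith
  qed
  show ?thesis
  proof (cases "x \<le> 1 / 2")
    case True
    then show ?thesis using * assms by simp
  next
    case False
    then show ?thesis using *[of "1 - x"] assms cospoly_one_minus[OF cp, of x] by simp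
  qed
qed

lemma int_f_le: "integral {0..1} f \<le> 2 * (4 / 3) ^ k * Rmax"
proof -
  have "integral {0..1} f \<le> integral {0..1::real} (\<lambda>_. 2 * (4 / 3) ^ k * Rmax)"
    by (intro integral_le cospoly_integrable[OF cp] f_le_Rmax) auto
  then show ?thesis by simp
qed

lemma Rmax_pos: "0 < Rmax"
proof (rule ccontr)
  assume "\<not> 0 < Rmax"
  then have "2 * (4 / 3) ^ k * Rmax \<le> 0" by (intro mult_nonneg_nonpos) auto
  then show False using int_f_le int_pos by linarith
qed

lemma f_near_one_third: "\<bar>f x - f (1 / 3)\<bar> \<le> 28 * (real k + 1)\<^sup>2 * (4 / 3) ^ k * Rmax * \<bar>x - 1 / 3\<bar>"
proof -
  have "\<bar>f x - f (1 / 3)\<bar> \<le> 14 * (real k + 1)\<^sup>2 * integral {0..1} f * \<bar>x - 1 / 3\<bar>"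
    using cospoly_lipschitz[OF cp nonneg, of x "1 / 3"] by (simp add: add.commute)
  also have "\<dots> \<le> 14 * (real k + 1)\<^sup>2 * (2 * (4 / 3) ^ k * Rmax) * \<bar>x - 1 / 3\<bar>"
    by (intro mult_right_mono mult_left_mono int_f_le) auto
  finally show ?thesis by (simp add: mult_ac)
qed

text \<open>Starting from a maximum point of \<open>R\<close>, \<open>2k\<close> steps lead within \<open>4\<^sup>-\<^sup>k\<close> of \<open>1/3\<close>, which beats the
  Lipschitz constant of \<open>f\<close>.\<close>

lemma Rmax_le:
  assumes small: "2 * real k * 0.85 ^ k + 56 * (real k + 1)\<^sup>2 * (1 / 3) ^ k \<le> 1 / 2"
    and two: "(1 + 5 * (1 / 4) ^ k) ^ k \<le> (2 :: real)"
  shows "Rmax \<le> 4 * f (1 / 3)"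
proof -
  obtain x where x: "x \<in> {0..1/2}" "R x = Rmax" using R_attains by blast
  define y where "y = ((\<lambda>x. (1 - x) / 2) ^^ (2 * k)) x"
  have "\<bar>x - 1 / 3\<bar> \<le> 1" using x by auto
  then have "(1 / 2) ^ (2 * k) * \<bar>x - 1 / 3\<bar> \<le> (1 / 2) ^ (2 * k) * 1"
    by (intro mult_left_mono) auto
  then have y: "\<bar>y - 1 / 3\<bar> \<le> (1 / 4) ^ k"
    unfolding y_def one_minus_half_iterate_dist by (simp add: power_mult power2_eq_square)
  have "wt y - wt (1 / 3) \<le> 5 * \<bar>y - 1 / 3\<bar>"
    using wt_lipschitz[of y "1 / 3"] by (rule abs_le_D1)
  then have "wt y \<le> 1 + 5 * (1 / 4) ^ k" using y by simp
  also have "\<dots> \<le> (1 + 5 * (1 / 4) ^ k) ^ 3"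
    by (intro self_le_power) auto
  finally have "wt_cbrt y ^ 3 \<le> (1 + 5 * (1 / 4) ^ k) ^ 3" by (simp add: wt_cbrt_cubed)
  then have "wt_cbrt y \<le> 1 + 5 * (1 / 4) ^ k"
    by (rule cube_le_cubeD) simp
  then have "wt_cbrt y ^ k \<le> (1 + 5 * (1 / 4) ^ k) ^ k"
    by (intro power_mono) auto
  then have cy: "wt_cbrt y ^ k \<le> 2" using two by linarith
  have "f y \<le> f (1 / 3) + 28 * (real k + 1)\<^sup>2 * (4 / 3) ^ k * Rmax * \<bar>y - 1 / 3\<bar>"
    using f_near_one_third[of y] by linarith
  also have "\<dots> \<le> f (1 / 3) + 28 * (real k + 1)\<^sup>2 * (4 / 3) ^ k * Rmax * (1 / 4) ^ k"
    using y Rmax_nonneg by (intro add_left_mono mult_left_mono) auto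
  also have "28 * (real k + 1)\<^sup>2 * (4 / 3) ^ k * Rmax * (1 / 4) ^ k = 28 * (real k + 1)\<^sup>2 * (1 / 3) ^ k * Rmax"
    by (simp add: power_divide)
  finally have "R y \<le> (f (1 / 3) + 28 * (real k + 1)\<^sup>2 * (1 / 3) ^ k * Rmax) * 2"
    unfolding R_def using cy nonneg Rmax_nonneg by (intro mult_mono) auto
  moreover have "Rmax \<le> real (2 * k) * 0.85 ^ k * Rmax + R y"
    using R_iterate[OF x(1), of "2 * k"] x(2) by (simp add: y_def)
  ultimately have "Rmax \<le> (2 * real k * 0.85 ^ k + 56 * (real k + 1)\<^sup>2 * (1 / 3) ^ k) * Rmax + 2 * f (1 / 3)"
    by (simp add: algebra_simps)
  \<comment> \<open>Half of \<open>Rmax\<close> is absorbed into the left-hand side.\<close>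
  also have "\<dots> \<le> 1 / 2 * Rmax + 2 * f (1 / 3)"
    using Rmax_nonneg by (intro add_right_mono mult_right_mono small)
  finally show ?thesis by simp
qed

section \<open>Expansion of the eigenvalue along the homoclinic orbit\<close>

lemma mu_eq: "(\<mu> - 1) * f (1 / 3) = Q 1 ^ k * f (hom 1)"
proof -
  have "\<mu> * f (1 / 3) = f (1 / 3) + Q 1 ^ k * f (hom 1)"
    using transfer_one_third[OF cp] eig[of "1 / 3"] by (simp only: Q_1 hom_1 One_nat_def)
  then show ?thesis by (simp add: algebra_simps)
qed

text \<open>The upper estimate keeps both branches and discards \<open>\<mu> \<ge> 1\<close>; its
  counterpart \<open>f_hom_ge\<close> keeps \<open>\<mu>\<close> and discards the branch off the
  orbit.\<close>

lemma f_hom_le: "f (hom n) \<le> wt (hom (Suc n)) ^ k * f (hom (Suc n)) + wt (hom n / 2) ^ k * f (hom n / 2)"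
  using f_le[of "hom n"] by (simp add: hom_Suc)

lemma f_hom_ge: "wt (hom (Suc n)) ^ k * f (hom (Suc n)) \<le> \<mu> * f (hom n)"
  using f_eq[of "hom n"] nonneg[of "hom n / 2"] by (simp add: hom_Suc)

lemma Q_f_hom_step:
  assumes "Q n ^ k * (wt (hom n / 2) ^ k * f (hom n / 2)) \<le> E"
  shows "Q n ^ k * f (hom n) \<le> Q (Suc n) ^ k * f (hom (Suc n)) + E"
proof -
  have "Q n ^ k * f (hom n) \<le> Q n ^ k * (wt (hom (Suc n)) ^ k * f (hom (Suc n)) + wt (hom n / 2) ^ k * f (hom n / 2))"
    by (intro mult_left_mono f_hom_le) auto
  then show ?thesis using assms by (simp add: Q_Suc power_mult_distrib algebra_simps)
qed

text \<open>Applying \<open>wt_f_le\<close> directly at \<open>5/24\<close> would give the rate \<open>0.259 > \<eta>\<^sup>2\<close>; one more backward step gains enough.\<close>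

lemma f_5_24: "f (5 / 24) \<le> 2 * 1.2 ^ k * Rmax"
proof -
  have h2: "hom 2 = 5 / 12" by (simp add: hom_def power2_eq_square)
  have "2 * (pi * (5 / 24)) = pi * hom 2" by (simp add: h2)
  then have "cos (2 * (pi * (5 / 24))) = hcos 2" by (simp only: hcos_def)
  \<comment> \<open>The square is (1 + \<open>hcos 2\<close>)/2, about 0.629. The value 0.8 is
    chosen so that 2/3 (1 + 0.8) = 1.2.\<close>
  then have "(cos (pi * (5 / 24)))\<^sup>2 \<le> 0.8\<^sup>2"
    using cos_double_cos[of "pi * (5 / 24)"] hom_bounds2 by (simp add: hom_bounds_def power2_eq_square)
  then have c: "cos (pi * (5 / 24)) \<le> 0.8"
    by (rule power2_le_imp_le) simp
  have "0 \<le> cos (pi * (5 / 24))" using pi_gt_zero by (intro cos_ge_zero) auto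
  moreover have "wt (x / 2) \<le> 1.2" if "0 \<le> cos (pi * x)" for x
    unfolding wt_half_eq using that by simp
  moreover have "wt ((1 - x) / 2) \<le> 1.2" if "cos (pi * x) \<le> 0.8" for x
    unfolding wt_half_reflect_eq using that by simp
  ultimately have "wt (5 / 24 / 2) \<le> 1.2" "wt ((1 - 5 / 24) / 2) \<le> 1.2"
    using c by blast+
  then have "(wt (5 / 24 / 2))\<^sup>2 \<le> 1.2\<^sup>2" "(wt ((1 - 5 / 24) / 2))\<^sup>2 \<le> 1.2\<^sup>2"
    by (intro power_mono; simp)+
  moreover have "(1.2 :: real)\<^sup>2 \<le> 1.2 ^ 3" by (intro power_increasing) auto
  ultimately have "(wt (5 / 24 / 2))\<^sup>2 \<le> 1.2 ^ 3" "(wt ((1 - 5 / 24) / 2))\<^sup>2 \<le> 1.2 ^ 3"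
    by linarith+
  then have "wt (5 / 24 / 2) ^ k * f (5 / 24 / 2) \<le> 1.2 ^ k * Rmax"
    "wt ((1 - 5 / 24) / 2) ^ k * f ((1 - 5 / 24) / 2) \<le> 1.2 ^ k * Rmax"
    by (intro wt_f_le; simp)+
  then show ?thesis using f_le[of "5 / 24"] by linarith
qed

text \<open>Each branch off the orbit must have a rate below \<open>\<eta>\<^sup>2\<close> =
  0.256036; here it is 1/3 times 0.3.\<close>

lemma Q_f_hom_1: "Q 1 ^ k * f (hom 1) \<le> Q 2 ^ k * f (hom 2) + (1 / 10) ^ k * Rmax"
proof -
  have "(wt (hom 1 / 2))\<^sup>2 \<le> 0.09\<^sup>2"
    using hom_bounds1 by (intro power_mono) (auto simp: wt_hom_half hom_bounds_def)
  also have "\<dots> \<le> 0.3 ^ 3" by (simp add: power2_eq_square power3_eq_cube)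
  finally have "wt (hom 1 / 2) ^ k * f (hom 1 / 2) \<le> 0.3 ^ k * Rmax"
    by (intro wt_f_le) (auto simp: hom_1)
  then have "Q 1 ^ k * (wt (hom 1 / 2) ^ k * f (hom 1 / 2)) \<le> (1 / 3) ^ k * (0.3 ^ k * Rmax)"
    unfolding One_nat_def Q_1 by (rule mult_left_mono) simp
  also have "\<dots> = (1 / 10) ^ k * Rmax" by (simp add: power_mult_distrib[symmetric] mult.assoc[symmetric])
  finally show ?thesis using Q_f_hom_step[of 1] by (simp add: numeral_2_eq_2)
qed

text \<open>The critical branch: 0.415 * 0.4942 * 1.2 is about 0.246, barely below 1/4.\<close>

lemma Q_f_hom_2: "Q 2 ^ k * f (hom 2) \<le> Q 3 ^ k * f (hom 3) + 2 * (1 / 4) ^ k * Rmax"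
proof -
  have h2: "hom 2 / 2 = 5 / 24" by (simp add: hom_def power2_eq_square)
  have "wt (hom 2 / 2) \<le> 0.4942"
    using hom_bounds2 by (simp add: wt_hom_half hom_bounds_def)
  then have "Q 2 * wt (hom 2 / 2) \<le> 0.415 * 0.4942"
    using Q_2_le by (intro mult_mono) auto
  then have "(Q 2 * wt (hom 2 / 2)) ^ k \<le> (0.415 * 0.4942) ^ k"
    by (intro power_mono) auto
  then have "Q 2 ^ k * (wt (hom 2 / 2) ^ k * f (hom 2 / 2)) \<le> (0.415 * 0.4942) ^ k * (2 * 1.2 ^ k * Rmax)"
    using mult_mono[OF _ f_5_24, of "(Q 2 * wt (hom 2 / 2)) ^ k" "(0.415 * 0.4942) ^ k"] nonneg
    by (simp only: h2 power_mult_distrib mult.assoc) simp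
  also have "\<dots> = 2 * (0.415 * 0.4942 * 1.2) ^ k * Rmax"
    by (simp only: power_mult_distrib mult_ac)
  also have "\<dots> \<le> 2 * (1 / 4) ^ k * Rmax"
    using Rmax_nonneg by (intro mult_right_mono mult_left_mono power_mono) auto
  finally show ?thesis using Q_f_hom_step[of 2] by (simp add: numeral_3_eq_3 numeral_2_eq_2)
qed

text \<open>From here on the bounds are uniform in \<open>n\<close>: 0.373^2 < 0.52^3 and 0.3735 *
  0.52 < 1/5, so summing costs only a factor linear in \<open>n\<close>.\<close>

lemma Q_f_hom_ge_3:
  assumes "3 \<le> n"
  shows "Q n ^ k * f (hom n) \<le> Q (Suc n) ^ k * f (hom (Suc n)) + (1 / 5) ^ k * Rmax"
proof (rule Q_f_hom_step)
  have "(wt (hom n / 2))\<^sup>2 \<le> 0.373\<^sup>2"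
    using wt_hom_half_le[OF assms] by (intro power_mono) auto
  also have "\<dots> \<le> 0.52 ^ 3" by (simp add: power2_eq_square power3_eq_cube)
  finally have "wt (hom n / 2) ^ k * f (hom n / 2) \<le> 0.52 ^ k * Rmax"
    using hom_range[of n] assms by (intro wt_f_le) auto
  moreover have "Q n ^ k \<le> 0.3735 ^ k" using Q_le[OF assms] by (intro power_mono) auto
  ultimately have "Q n ^ k * (wt (hom n / 2) ^ k * f (hom n / 2)) \<le> 0.3735 ^ k * (0.52 ^ k * Rmax)"
    using nonneg by (intro mult_mono[of "Q n ^ k"]) auto
  also have "\<dots> = (0.3735 * 0.52) ^ k * Rmax" by (simp only: power_mult_distrib mult_ac)
  also have "\<dots> \<le> (1 / 5) ^ k * Rmax"
    using Rmax_nonneg by (intro mult_right_mono power_mono) auto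
  finally show "Q n ^ k * (wt (hom n / 2) ^ k * f (hom n / 2)) \<le> (1 / 5) ^ k * Rmax" .
qed

lemma Q_f_hom_expand:
  assumes "3 \<le> n"
  shows "Q 1 ^ k * f (hom 1) \<le> Q n ^ k * f (hom n) + ((1 / 10) ^ k + 2 * (1 / 4) ^ k + real n * (1 / 5) ^ k) * Rmax"
  using assms
proof (induction n rule: dec_induct)
  case base
  have "0 \<le> (1 / 5) ^ k * Rmax" using Rmax_nonneg by (intro mult_nonneg_nonneg) auto
  then show ?case using Q_f_hom_1 Q_f_hom_2 by (simp add: algebra_simps)
next
  case (step n)
  then show ?case using Q_f_hom_ge_3[of n] by (simp add: distrib_right)
qed

text \<open>The reverse of the expansion: dropping the nonnegative branches off the orbit costs one
  factor \<open>\<mu>\<close> per step.\<close>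

lemma Q_f_hom_iterate: "Q (Suc n) ^ k * f (hom (Suc n)) \<le> \<mu> ^ n * (Q 1 ^ k * f (hom 1))"
proof (induction n)
  case (Suc n)
  have "Q (Suc (Suc n)) ^ k * f (hom (Suc (Suc n))) = Q (Suc n) ^ k * (wt (hom (Suc (Suc n))) ^ k * f (hom (Suc (Suc n))))"
    by (simp add: Q_Suc[of "Suc n"] power_mult_distrib)
  also have "\<dots> \<le> Q (Suc n) ^ k * (\<mu> * f (hom (Suc n)))"
    by (intro mult_left_mono f_hom_ge) auto
  also have "\<dots> = \<mu> * (Q (Suc n) ^ k * f (hom (Suc n)))" by simp
  also have "\<dots> \<le> \<mu> * (\<mu> ^ n * (Q 1 ^ k * f (hom 1)))"
    using mu by (intro mult_left_mono Suc) auto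
  finally show ?case by (simp add: mult_ac)
qed simp

text \<open>At index \<open>4 * k\<close> the orbit is within 16^(-k) of 1/3, against a Lipschitz
  constant of order (4/3)^k up to polynomial factors; their product has rate 1/12.\<close>

lemma f_hom_near:
  assumes "Rmax \<le> 4 * f (1 / 3)"
  shows "\<bar>f (hom (4 * k)) - f (1 / 3)\<bar> \<le> 112 * (real k + 1)\<^sup>2 * (1 / 12) ^ k * f (1 / 3)"
proof -
  have "\<bar>hom (4 * k) - 1 / 3\<bar> \<le> (1 / 2) ^ (4 * k)"
    unfolding hom_dist by simp
  also have "\<dots> = (1 / 16) ^ k" by (simp add: power_mult power_divide)
  finally have "\<bar>f (hom (4 * k)) - f (1 / 3)\<bar> \<le> 28 * (real k + 1)\<^sup>2 * (4 / 3) ^ k * (4 * f (1 / 3)) * (1 / 16) ^ k"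
    using f_near_one_third[of "hom (4 * k)"] assms Rmax_nonneg nonneg
    by (elim order.trans) (intro mult_mono mult_nonneg_nonneg, auto)
  also have "\<dots> = 112 * (real k + 1)\<^sup>2 * ((4 / 3) ^ k * (1 / 16) ^ k) * f (1 / 3)" by simp
  also have "(4 / 3 :: real) ^ k * (1 / 16) ^ k = (1 / 12) ^ k"
    by (simp flip: power_mult_distrib)
  finally show ?thesis .
qed

text \<open>The upper bound is the expansion up to index \<open>4 * k\<close>, with the endpoint
  value replaced by \<open>f (1 / 3)\<close>. The lower bound iterates in reverse; a crude bound on
  \<open>\<mu> - 1\<close> then controls the lost power of \<open>\<mu>\<close>.\<close>

lemma mu_bounds:
  assumes "1 \<le> k"
    and R: "Rmax \<le> 4 * f (1 / 3)"
    and eps: "112 * (real k + 1)\<^sup>2 * (1 / 12) ^ k \<le> 1"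
  shows "\<bar>\<mu> - 1 - Q (4 * k) ^ k\<bar>
    \<le> 112 * (real k + 1)\<^sup>2 * (1 / 12) ^ k + 4 * (1 / 10) ^ k + 8 * (1 / 4) ^ k + 16 * real k * (1 / 5) ^ k"
proof -
  define \<epsilon> where "\<epsilon> = 112 * (real k + 1)\<^sup>2 * (1 / 12) ^ k"
  define F where "F = f (1 / 3)"
  define q where "q = Q (4 * k) ^ k"
  have F: "0 < F" using R Rmax_pos by (simp add: F_def)
  have q: "0 \<le> q" "q \<le> 1" using Q_le_1 by (auto simp: q_def power_le_one)
  have \<epsilon>: "0 \<le> \<epsilon>" "\<epsilon> \<le> 1" using eps by (auto simp: \<epsilon>_def)
  have near: "\<bar>f (hom (4 * k)) - F\<bar> \<le> \<epsilon> * F"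
    using f_hom_near[OF R] by (simp add: \<epsilon>_def F_def)
  have n: "3 \<le> 4 * k" using assms by simp
  have *: "(\<mu> - 1) * F = Q 1 ^ k * f (hom 1)" using mu_eq by (simp add: F_def)

  have "(\<mu> - 1) * F \<le> q * f (hom (4 * k)) + ((1 / 10) ^ k + 2 * (1 / 4) ^ k + real (4 * k) * (1 / 5) ^ k) * Rmax"
    using Q_f_hom_expand[OF n] by (simp only: * q_def)
  also have "\<dots> \<le> (q + \<epsilon>) * F + ((1 / 10) ^ k + 2 * (1 / 4) ^ k + real (4 * k) * (1 / 5) ^ k) * (4 * F)"
  proof (rule add_mono)
    have "q * f (hom (4 * k)) \<le> q * (F + \<epsilon> * F)"
      using near q by (intro mult_left_mono) auto
    also have "\<dots> = q * F + q * (\<epsilon> * F)" by (simp add: distrib_left)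
    also have "q * (\<epsilon> * F) \<le> 1 * (\<epsilon> * F)"
      using q F \<epsilon> by (intro mult_right_mono) auto
    finally show "q * f (hom (4 * k)) \<le> (q + \<epsilon>) * F" by (simp add: distrib_right)
  qed (use R in \<open>auto intro!: mult_left_mono simp: F_def\<close>)
  also have "\<dots> = (q + \<epsilon> + 4 * (1 / 10) ^ k + 8 * (1 / 4) ^ k + 16 * real k * (1 / 5) ^ k) * F"
    by (simp add: algebra_simps)
  finally have upper: "\<mu> - 1 \<le> q + \<epsilon> + 4 * (1 / 10) ^ k + 8 * (1 / 4) ^ k + 16 * real k * (1 / 5) ^ k"
    using F by simp

  \<comment> \<open>Crude a priori rate: the squared weight of \<open>hom 1\<close> is 1/9 <
    0.49^3.\<close>
  have "(\<mu> - 1) * F \<le> 0.49 ^ k * Rmax"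
  proof -
    have "(wt (hom 1))\<^sup>2 \<le> 0.49 ^ 3"
      unfolding wt_hom_1 by (simp add: power2_eq_square power3_eq_cube)
    then have "wt (hom 1) ^ k * f (hom 1) \<le> 0.49 ^ k * Rmax"
      using hom_range[of 1] by (intro wt_f_le) auto
    then show ?thesis by (simp add: * Q_def)
  qed
  also have "\<dots> \<le> 0.49 ^ k * (4 * F)"
    using R by (intro mult_left_mono) (auto simp: F_def)
  finally have mu_le: "\<mu> - 1 \<le> 4 * 0.49 ^ k" using F by simp
  \<comment> \<open>Prepares Bernoulli's inequality for the power of
    \<open>1 / \<mu>\<close>.\<close>
  have "1 - real (4 * k) * (\<mu> - 1) \<le> 1 + real (4 * k) * (1 / \<mu> - 1)"
  proof -
    have "0 \<le> (\<mu> - 1) * (1 - 1 / \<mu>)" using mu by (intro mult_nonneg_nonneg) auto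
    then have "1 - 1 / \<mu> \<le> \<mu> - 1" using mu by (simp add: field_simps)
    then have "real (4 * k) * (1 - 1 / \<mu>) \<le> real (4 * k) * (\<mu> - 1)" by (intro mult_left_mono) auto
    then show ?thesis by (simp add: algebra_simps)
  qed
  also have "\<dots> \<le> (1 + (1 / \<mu> - 1)) ^ (4 * k)"
    using mu by (intro Bernoulli_inequality) auto
  finally have bern: "1 - 16 * real k * 0.49 ^ k \<le> (1 / \<mu>) ^ (4 * k)"
    using mult_left_mono[OF mu_le, of "4 * real k"] by simp
  obtain m where m: "4 * k = Suc m" using assms by (cases k) auto
  have "q * (F - \<epsilon> * F) \<le> q * f (hom (4 * k))"
    using near q by (intro mult_left_mono) auto
  also have "\<dots> \<le> \<mu> ^ m * ((\<mu> - 1) * F)"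
    using Q_f_hom_iterate[of m] by (simp add: q_def m *)
  also have "\<dots> \<le> \<mu> ^ (4 * k) * ((\<mu> - 1) * F)"
    using mu F m by (intro mult_right_mono power_increasing) auto
  finally have "(q * (1 - \<epsilon>)) * F \<le> (\<mu> ^ (4 * k) * (\<mu> - 1)) * F"
    by (simp add: algebra_simps)
  then have "q * (1 - \<epsilon>) \<le> \<mu> ^ (4 * k) * (\<mu> - 1)" using F by simp
  then have "(1 / \<mu>) ^ (4 * k) * (q * (1 - \<epsilon>)) \<le> \<mu> - 1"
    using mu by (simp add: field_simps)
  moreover have "(1 - 16 * real k * 0.49 ^ k) * (q * (1 - \<epsilon>)) \<le> (1 / \<mu>) ^ (4 * k) * (q * (1 - \<epsilon>))"
    using bern q \<epsilon> by (intro mult_right_mono) auto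
  moreover have "q - 16 * real k * (1 / 5) ^ k - \<epsilon> \<le> (1 - 16 * real k * 0.49 ^ k) * (q * (1 - \<epsilon>))"
  proof -
    \<comment> \<open>The rate 0.49 alone would exceed \<open>\<eta>\<^sup>2\<close>, but it occurs
      only multiplied by \<open>q\<close>, and 0.3735 * 0.49 < 1/5.\<close>
    have "q * 0.49 ^ k \<le> 0.3735 ^ k * 0.49 ^ k"
      unfolding q_def using Q_le[OF n] by (intro mult_right_mono power_mono) auto
    also have "\<dots> = (0.3735 * 0.49) ^ k" by (simp only: power_mult_distrib)
    also have "\<dots> \<le> (1 / 5) ^ k" by (intro power_mono) auto
    finally have "16 * real k * (q * 0.49 ^ k) \<le> 16 * real k * (1 / 5) ^ k"
      by (intro mult_left_mono) auto
    moreover have "q * \<epsilon> \<le> 1 * \<epsilon>" using q \<epsilon> by (intro mult_right_mono) auto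
    moreover have "0 \<le> 16 * real k * 0.49 ^ k * (q * \<epsilon>)" using q \<epsilon> by (intro mult_nonneg_nonneg) auto
    ultimately show ?thesis by (simp add: algebra_simps)
  qed
  moreover have "0 \<le> 4 * (1 / 10 :: real) ^ k + 8 * (1 / 4) ^ k" by simp
  ultimately show ?thesis using upper unfolding q_def[symmetric] \<epsilon>_def[symmetric] by linarith
qed

end

section \<open>From the moments to the asymptotics of the growth rate\<close>

lemma growth_asymptotics:
  assumes "0 < \<rho>" "0 < C" "M k \<sim>[sequentially] (\<lambda>n. C * \<rho> ^ n)"
  shows "(\<lambda>n. integral {0..1} ((transfer k ^^ n) (\<lambda>_. 1)) / (\<rho> / (3 ^ k / 2)) ^ n) \<longlonglongrightarrow> C"
proof -
  have "(\<lambda>n. M k n / (C * \<rho> ^ n)) \<longlonglongrightarrow> 1"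
    using asymp_equivD_strong[OF assms(3)] assms(1,2) by simp
  from tendsto_mult[OF this tendsto_const[of C]]
  have "(\<lambda>n. M k n / (C * \<rho> ^ n) * C) \<longlonglongrightarrow> C" by simp
  also have "(\<lambda>n. M k n / (C * \<rho> ^ n) * C)
      = (\<lambda>n. integral {0..1} ((transfer k ^^ n) (\<lambda>_. 1)) / (\<rho> / (3 ^ k / 2)) ^ n)"
    using assms(1,2) by (simp add: M_eq power_divide field_simps)
  finally show ?thesis .
qed

theorem theorem1p1:
  fixes \<rho> :: "nat \<Rightarrow> real"
  assumes "\<And>k. k \<ge> 1 \<Longrightarrow> \<rho> k > 0"
    and "\<And>k. k \<ge> 1 \<Longrightarrow> \<exists>C>0. M k \<sim>[sequentially] (\<lambda>n. C * \<rho> k ^ n)"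
  shows "0.6027 \<le> \<delta>\<^sub>1 \<and> \<delta>\<^sub>1 < 0.6028 \<and>
    (\<exists>C. \<forall>k\<ge>1. \<bar>\<rho> k / (1 / 2 * 3 ^ k) - 1 - \<delta>\<^sub>1 ^ (2 * k)\<bar> \<le> C * \<eta> ^ (2 * k))"
proof -
  define D where "D k = \<bar>\<rho> k / (1 / 2 * 3 ^ k) - 1 - \<delta>\<^sub>1 ^ (2 * k)\<bar>" for k
  \<comment> \<open>The last term pays for replacing \<open>Q (4 * k)\<close> by its limit; the
    others come from \<open>mu_bounds\<close>.\<close>
  define err :: "nat \<Rightarrow> real" where "err k = 112 * (real k + 1)\<^sup>2 * (1 / 12) ^ k + 4 * (1 / 10) ^ k
    + 8 * (1 / 4) ^ k + 16 * real k * (1 / 5) ^ k + 2 * real k * (1 / 16) ^ k" for k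
  have "\<forall>\<^sub>F k in sequentially. 2 * real k * 0.85 ^ k + 56 * (real k + 1)\<^sup>2 * (1 / 3) ^ k \<le> 1 / 2"
    by real_asymp
  moreover have "\<forall>\<^sub>F k in sequentially. (1 + 5 * (1 / 4) ^ k) ^ k \<le> (2 :: real)"
    by real_asymp
  moreover have "\<forall>\<^sub>F k in sequentially. 112 * (real k + 1)\<^sup>2 * (1 / 12) ^ k \<le> 1"
    by real_asymp
  moreover have "\<forall>\<^sub>F k in sequentially. err k \<le> (32 / 125) ^ k"
  proof -
    \<comment> \<open>Here 32/125 = 0.256 lies just below \<open>\<eta>\<^sup>2\<close>, and each
      base is a base in \<open>err\<close> divided by 32/125. The tightest, 125/128, comes from
      1/4.\<close>
    have "(\<lambda>k. 112 * (real k + 1)\<^sup>2 * (125 / 384) ^ k) \<longlonglongrightarrow> 0" "(\<lambda>k. 4 * (25 / 64 :: real) ^ k) \<longlonglongrightarrow> 0"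
      "(\<lambda>k. 8 * (125 / 128 :: real) ^ k) \<longlonglongrightarrow> 0" "(\<lambda>k. 16 * real k * (25 / 32) ^ k) \<longlonglongrightarrow> 0"
      "(\<lambda>k. 2 * real k * (125 / 512) ^ k) \<longlonglongrightarrow> 0"
      by real_asymp+
    then have "(\<lambda>k. 112 * (real k + 1)\<^sup>2 * (125 / 384) ^ k + 4 * (25 / 64) ^ k
      + 8 * (125 / 128) ^ k + 16 * real k * (25 / 32) ^ k + 2 * real k * (125 / 512) ^ k) \<longlonglongrightarrow> 0"
      by (intro tendsto_add_zero)
    then have "\<forall>\<^sub>F k in sequentially. 112 * (real k + 1)\<^sup>2 * (125 / 384) ^ k + 4 * (25 / 64) ^ k
      + 8 * (125 / 128) ^ k + 16 * real k * (25 / 32) ^ k + 2 * real k * (125 / 512) ^ k < 1"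
      by (rule order_tendstoD) simp
    then show ?thesis
    proof eventually_elim
      case (elim k)
      have *: "(32 / 125 * c) ^ k = (32 / 125) ^ k * c ^ k" for c :: real
        by (rule power_mult_distrib)
      have "err k = (32 / 125) ^ k * (112 * (real k + 1)\<^sup>2 * (125 / 384) ^ k + 4 * (25 / 64) ^ k
        + 8 * (125 / 128) ^ k + 16 * real k * (25 / 32) ^ k + 2 * real k * (125 / 512) ^ k)"
        using *[of "125 / 384"] *[of "25 / 64"] *[of "125 / 128"] *[of "25 / 32"] *[of "125 / 512"]
        by (simp add: err_def distrib_left)
      also have "\<dots> \<le> (32 / 125) ^ k * 1"
        using elim by (intro mult_left_mono) auto
      finally show ?case by simp
    qed
  qed
  ultimately have "\<forall>\<^sub>F k in sequentially. D k \<le> \<eta> ^ (2 * k)"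
    using eventually_ge_at_top[of 1]
  proof eventually_elim
    case (elim k)
    define \<mu> where "\<mu> = \<rho> k / (3 ^ k / 2)"
    have \<rho>: "0 < \<rho> k" using assms(1) elim by simp
    then have mu_pos: "0 < \<mu>" by (simp add: \<mu>_def)
    obtain C where C: "0 < C" "M k \<sim>[sequentially] (\<lambda>n. C * \<rho> k ^ n)" using assms(2) elim by blast
    note lim = growth_asymptotics[OF \<rho> C, folded \<mu>_def]
    obtain f where "cospoly k f" "\<And>x. 0 \<le> f x" "0 < integral {0..1} f" "\<And>x. transfer k f x = \<mu> * f x"
      using eigenfunction_exists[OF lim C(1) mu_pos] by blast
    then interpret eigenfunction k \<mu> f
      using growth_ge_1[OF lim mu_pos] by unfold_locales
    have "\<bar>\<mu> - 1 - Q (4 * k) ^ k\<bar> \<le> err k - 2 * real k * (1 / 16) ^ k"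
      unfolding err_def using mu_bounds[OF _ Rmax_le] elim by simp
    moreover have "\<bar>Q (4 * k) ^ k - (\<delta>\<^sub>1\<^sup>2) ^ k\<bar> \<le> 2 * real k * (1 / 16) ^ k"
    proof -
      have "\<delta>\<^sub>1\<^sup>2 \<le> 1" using delta_bounds delta_nonneg by (intro power_le_one) auto
      then have "\<bar>Q (4 * k) ^ k - (\<delta>\<^sub>1\<^sup>2) ^ k\<bar> \<le> real k * \<bar>Q (4 * k) - \<delta>\<^sub>1\<^sup>2\<bar>"
        using norm_power_diff[of "Q (4 * k)" "\<delta>\<^sub>1\<^sup>2" k] Q_le_1 by simp
      also have "\<dots> \<le> real k * (2 * (1 / 2) ^ (4 * k))"
        by (intro mult_left_mono Q_dist) auto
      also have "\<dots> = 2 * real k * (1 / 16) ^ k" by (simp add: power_mult power_divide)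
      finally show ?thesis .
    qed
    ultimately have "\<bar>\<mu> - 1 - (\<delta>\<^sub>1\<^sup>2) ^ k\<bar> \<le> err k" by linarith
    then have "D k \<le> err k" by (simp add: D_def \<mu>_def power_mult)
    also have "\<dots> \<le> (32 / 125) ^ k" using elim by simp
    also have "\<dots> \<le> (\<eta>\<^sup>2) ^ k" by (intro power_mono) (auto simp: \<eta>_def power2_eq_square)
    finally show ?case by (simp add: power_mult)
  qed
  then obtain k0 where k0: "\<And>k. k \<ge> k0 \<Longrightarrow> D k \<le> \<eta> ^ (2 * k)"
    by (auto simp: eventually_sequentially)
  \<comment> \<open>The finitely many \<open>k\<close> below \<open>k0\<close> are absorbed into the
    constant; the summand 1 covers all others.\<close>
  define C where "C = 1 + (\<Sum>k<k0. D k / \<eta> ^ (2 * k))"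
  have \<eta>: "0 < \<eta> ^ n" for n by (simp add: \<eta>_def)
  have sum_nonneg: "0 \<le> (\<Sum>k<k0. D k / \<eta> ^ (2 * k))"
    using \<eta> by (intro sum_nonneg divide_nonneg_pos) (auto simp: D_def)
  have "D k \<le> C * \<eta> ^ (2 * k)" for k
  proof (cases "k < k0")
    case True
    then have "D k / \<eta> ^ (2 * k) \<le> (\<Sum>k<k0. D k / \<eta> ^ (2 * k))"
      using \<eta> by (intro member_le_sum) (auto simp: D_def intro!: divide_nonneg_pos)
    then have "D k / \<eta> ^ (2 * k) \<le> C" by (simp add: C_def)
    then show ?thesis using \<eta>[of "2 * k"] by (simp add: divide_le_eq)
  next
    case False
    then have "D k \<le> 1 * \<eta> ^ (2 * k)" using k0 by simp
    also have "\<dots> \<le> C * \<eta> ^ (2 * k)"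
      using \<eta>[of "2 * k"] sum_nonneg by (intro mult_right_mono) (auto simp: C_def)
    finally show ?thesis .
  qed
  then show ?thesis using delta_bounds by (auto simp: D_def)
qed

end
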